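(* Consider the four-color urn model (white, black, green, yellow) with replacement matrix $$R=\begin{pmatrix} sQ & E\\ 0 & P\end{pmatrix},$$ a stochastic matrix with $2\times2$ blocks, where $0<s<1$ and $P,Q$ are irreducible stochastic matrices; $\boldsymbol\pi_P$ is the stationary distribution (row vector) of $P$; the eigenvalues of $Q$ are $\lambda$ and $1$ with $|\lambda|<1$, and those of $P$ are $\beta$ and $1$ with $|\beta|<1$. Assume $W_0+B_0>0$. Assume that all the eigenvalues $s\lambda, s,\beta,1$ of $R$ are distinct. Let $\boldsymbol v_3$ be a right eigenvector of $R$ corresponding to $\beta$, and let $\boldsymbol\nu$ be the two-dimensional vector formed by the lower half (last two coordinates) of $\boldsymbol v_3$. Then: (i) If $\beta<1/2$, then $\boldsymbol C_n\boldsymbol v_3/\sqrt n\Rightarrow N\left(0,\frac{\beta^2}{1-2\beta}\boldsymbol\pi_P\boldsymbol\nu^2\right)$. (ii) If $\beta=1/2$, then $\boldsymbol C_n\boldsymbol v_3/\sqrt{n\log n}\Rightarrow N\left(0,\beta^2\boldsymbol\pi_P\boldsymbol\nu^2\right)$. (iii) If $\beta>1/2$, then $\boldsymbol C_n\boldsymbol v_3/\Pi_n(\beta)$ is an $L^2$-bounded martingale and $\boldsymbol C_n\boldsymbol v_3/n^\beta$ converges almost surely to a non-degenerate random variable.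
   Context: Urn model: there are $K$ colors (here $K=4$). $\boldsymbol C_0=(W_0,B_0,G_0,Y_0)$ is a row probability vector (non-negative real coordinates summing to $1$) giving the initial "numbers of balls" of each color, and $R=((r_{ij}))$ is a non-random $K\times K$ stochastic matrix. $\boldsymbol C_n=(W_n,B_n,G_n,Y_n)$ is the row vector of the numbers of balls of each color after the $n$-th trial. At the $n$-th trial a ball is drawn at random, so that, given the past, color $i$ appears with probability $\boldsymbol C_{i,n-1}/n$ (the total after $n-1$ trials is $n$); if color $i$ appears, then for every $j$ the number of balls of color $j$ is increased by $r_{ij}$. The filtration $\mathcal F_n$ is the natural filtration of $(\boldsymbol C_n)$; martingales are with respect to it. Notation: For a vector $\boldsymbol\nu$, $\boldsymbol\nu^2$ is the vector of squared coordinates. $\Pi_n(\beta)=\prod_{j=0}^{n-1}\left(1+\frac{\beta}{j+1}\right)$. $\Rightarrow$ denotes convergence in distribution. *)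

theory Defs
  imports "HOL-Probability.Probability"
begin

section \<open>Matrices\<close>

definition prob_vector :: "real ^ 'n::finite \<Rightarrow> bool" where
  "prob_vector p \<longleftrightarrow> (\<forall>i. 0 \<le> p $ i) \<and> (\<Sum>i\<in>UNIV. p $ i) = 1"

definition stochastic_matrix :: "real ^ 'n ^ 'n::finite \<Rightarrow> bool" where
  "stochastic_matrix A \<longleftrightarrow> (\<forall>i. prob_vector (row i A))"

definition irreducible_matrix :: "real ^ 'n ^ 'n::finite \<Rightarrow> bool" where
  "irreducible_matrix A \<longleftrightarrow> (\<forall>i j. \<exists>n. 0 < (((**) A) ^^ n) (mat 1) $ i $ j)"

definition stationary_distribution :: "real ^ 'n \<Rightarrow> real ^ 'n ^ 'n::finite \<Rightarrow> bool" where
  "stationary_distribution p A \<longleftrightarrow> prob_vector p \<and> p v* A = p"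

definition right_eigenvector :: "real ^ 'n ^ 'n::finite \<Rightarrow> real \<Rightarrow> real ^ 'n \<Rightarrow> bool" where
  "right_eigenvector A l v \<longleftrightarrow> v \<noteq> 0 \<and> A *v v = l *\<^sub>R v"

text \<open>Real eigenvalues. A stochastic \<open>2 \<times> 2\<close> matrix has no non-real ones: one of its two
  eigenvalues is \<open>1\<close> and the other is its trace minus \<open>1\<close>.\<close>

definition eigenvalues :: "real ^ 'n ^ 'n::finite \<Rightarrow> real set" where
  "eigenvalues A = {l. \<exists>v. right_eigenvector A l v}"

text \<open>The block matrix with rows \<open>(A, B)\<close> and \<open>(C, D)\<close>; the disjoint sum of the index types
  keeps track of the blocks.\<close>

definition block_matrix ::
  "real ^ 'm ^ 'm::finite \<Rightarrow> real ^ 'n ^ 'm \<Rightarrow> real ^ 'm ^ 'n \<Rightarrow> real ^ 'n ^ 'n::finite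
    \<Rightarrow> real ^ ('m + 'n) ^ ('m + 'n)" where
  "block_matrix A B C D = (\<chi> i j.
     (case i of
        Inl a \<Rightarrow> (case j of Inl b \<Rightarrow> A $ a $ b | Inr b \<Rightarrow> B $ a $ b)
      | Inr a \<Rightarrow> (case j of Inl b \<Rightarrow> C $ a $ b | Inr b \<Rightarrow> D $ a $ b)))"

definition lower_half :: "real ^ ('m::finite + 'n::finite) \<Rightarrow> real ^ 'n" where
  "lower_half v = (\<chi> i. v $ Inr i)"

definition square_vec :: "real ^ 'n \<Rightarrow> real ^ 'n" where
  "square_vec v = (\<chi> i. (v $ i)\<^sup>2)"


section \<open>Probability\<close>

definition natural_filtration ::
  "'a measure \<Rightarrow> (nat \<Rightarrow> 'a \<Rightarrow> 'b::topological_space) \<Rightarrow> nat \<Rightarrow> 'a measure" where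
  "natural_filtration M Z n =
     sigma (space M) (\<Union>m\<in>{..n}. {Z m -` A \<inter> space M |A. A \<in> sets borel})"

definition martingale ::
  "'a measure \<Rightarrow> (nat \<Rightarrow> 'a measure) \<Rightarrow> (nat \<Rightarrow> 'a \<Rightarrow> real) \<Rightarrow> bool" where
  "martingale M F Z \<longleftrightarrow>
     (\<forall>n. subalgebra M (F n)) \<and> filtration (space M) F \<and>
     (\<forall>n. Z n \<in> borel_measurable (F n)) \<and>
     (\<forall>n. integrable M (Z n)) \<and>
     (\<forall>m n. m \<le> n \<longrightarrow> (AE \<omega> in M. real_cond_exp M (F m) (Z n) \<omega> = Z m \<omega>))"

definition L2_bounded :: "'a measure \<Rightarrow> (nat \<Rightarrow> 'a \<Rightarrow> real) \<Rightarrow> bool" where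
  "L2_bounded M Z \<longleftrightarrow>
     (\<forall>n. Z n \<in> borel_measurable M) \<and>
     (\<forall>n. integrable M (\<lambda>\<omega>. (Z n \<omega>)\<^sup>2)) \<and>
     (\<exists>B. \<forall>n. (\<integral>\<omega>. (Z n \<omega>)\<^sup>2 \<partial>M) \<le> B)"

text \<open>The second parameter is the variance; with variance \<open>0\<close> the normal law is the point mass
  at the mean, which \<^const>\<open>normal_density\<close> does not cover.\<close>

definition normal_law :: "real \<Rightarrow> real \<Rightarrow> real measure" where
  "normal_law m v = (if v = 0 then return borel m else density lborel (normal_density m (sqrt v)))"

definition converges_in_distribution ::
  "'a measure \<Rightarrow> (nat \<Rightarrow> 'a \<Rightarrow> real) \<Rightarrow> real measure \<Rightarrow> bool" where
  "converges_in_distribution M Z N \<longleftrightarrow>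
     (\<forall>n. Z n \<in> borel_measurable M) \<and> weak_conv_m (\<lambda>n. distr M borel (Z n)) N"

definition nondegenerate :: "'a measure \<Rightarrow> ('a \<Rightarrow> real) \<Rightarrow> bool" where
  "nondegenerate M Z \<longleftrightarrow> Z \<in> borel_measurable M \<and> \<not> (\<exists>c. AE \<omega> in M. Z \<omega> = c)"


section \<open>The urn model\<close>

text \<open>\<open>C n\<close> is the composition after trial \<open>n\<close> and \<open>X n\<close>, for \<open>n \<ge> 1\<close>, the colour drawn at
  trial \<open>n\<close>; \<open>X 0\<close> plays no role.\<close>

locale urn_process = prob_space M for M :: "'a measure" +
  fixes R :: "real ^ 'k ^ 'k::finite"
    and c0 :: "real ^ 'k"
    and X :: "nat \<Rightarrow> 'a \<Rightarrow> 'k"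
    and C :: "nat \<Rightarrow> 'a \<Rightarrow> real ^ 'k"
  assumes stochastic_replacement: "stochastic_matrix R"
    and prob_vector_c0: "prob_vector c0"
    and measurable_draw: "\<And>n. X n \<in> measurable M (count_space UNIV)"
    and initial: "\<And>\<omega>. \<omega> \<in> space M \<Longrightarrow> C 0 \<omega> = c0"
    and replacement: "\<And>n \<omega>. \<omega> \<in> space M \<Longrightarrow> C (Suc n) \<omega> = C n \<omega> + row (X (Suc n) \<omega>) R"
    and draw: "\<And>n i. AE \<omega> in M.
      real_cond_exp M (natural_filtration M C n) (indicator {\<omega> \<in> space M. X (Suc n) \<omega> = i}) \<omega>
        = C n \<omega> $ i / real (Suc n)"

text \<open>White and black form the first block, green and yellow the second.\<close>

type_synonym colour = "2 + 2"

abbreviation white :: colour where "white \<equiv> Inl 1"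
abbreviation black :: colour where "black \<equiv> Inl 2"
abbreviation green :: colour where "green \<equiv> Inr 1"
abbreviation yellow :: colour where "yellow \<equiv> Inr 2"

definition Pi_norm :: "nat \<Rightarrow> real \<Rightarrow> real" where
  "Pi_norm n b = (\<Prod>j<n. 1 + b / (real j + 1))"

end

theory Submission
  imports Defs "HOL-Real_Asymp.Real_Asymp"
begin

text \<open>Write \<open>S\<^sub>n = C\<^sub>n \<bullet> v\<close> for a right eigenvector \<open>v\<close> of the replacement matrix with eigenvalue \<open>\<beta>\<close>. Drawing
colour \<open>i\<close> adds \<open>\<beta> v\<^sub>i\<close> to \<open>S\<^sub>n\<close>, and the drawn \<open>v\<^sub>i\<close> has conditional mean \<open>S\<^sub>n / (n + 1)\<close> and conditional
second moment \<open>V\<^sub>n = C\<^sub>n \<bullet> v\<^sup>2 / (n + 1)\<close>. Everything follows from this autoregression.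

\<^bold>\<open>Law of large numbers.\<close> Squaring the autoregression shows that the second moment of \<open>C\<^sub>n \<bullet> u\<close> is
\<open>o(n\<^sup>2)\<close> for every eigenvector \<open>u\<close> with eigenvalue below 1 (\<open>second_moment_negligible\<close>). For the
four-colour matrix, \<open>v\<^sup>2\<close> is a constant vector plus such eigenvectors: the lower half of \<open>v\<close> is an
eigenvector of \<open>P\<close> with two different entries, so it spans the lower half together with the constants,
and the eigenvectors of \<open>Q\<close>, extended by zero, span what remains above. Hence \<open>V\<^sub>n\<close> converges in \<open>L\<^sup>1\<close> to
a number \<open>\<tau>\<close>, which pairing with the stationary distribution of \<open>P\<close> identifies as the value of
\<open>\<pi>\<^sub>P \<bullet> \<nu>\<^sup>2\<close>.

\<^bold>\<open>Central limit theorems.\<close> Because the limit \<open>\<tau>\<close> of the conditional variances is deterministic, the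
characteristic functions \<open>f\<^sub>n\<close> of \<open>S\<^sub>n\<close> obey a closed approximate recursion,
\<open>f\<^sub>n\<^sub>+\<^sub>1(\<theta>) \<approx> exp (- \<beta>\<^sup>2 \<tau> \<theta>\<^sup>2 / 2) f\<^sub>n(\<theta> (1 + \<beta> / (n + 1)))\<close>, with an error that is small compared
to \<open>\<theta>\<^sup>2\<close> for large \<open>n\<close> and small \<open>\<theta>\<close> (\<open>char_step\<close>).
Running it backwards from \<open>\<theta> = t / A\<^sub>N\<close> down to \<open>f\<^sub>0\<close>, the arguments met on the way are
\<open>t \<Pi>\<^sub>N / (A\<^sub>N \<Pi>\<^sub>k)\<close> and the Gaussian factors multiply to \<open>exp (- \<beta>\<^sup>2 \<tau> L t\<^sup>2 / 2)\<close>, where \<open>L\<close> is the limit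
of the sum over \<open>1 \<le> k \<le> N\<close> of \<open>(\<Pi>\<^sub>N / (A\<^sub>N \<Pi>\<^sub>k))\<^sup>2\<close> (\<open>char_recursion_limit\<close>). The Stolz-Cesaro
theorem evaluates it: \<open>L = 1 / (1 - 2 \<beta>)\<close> for the norming \<open>A\<^sub>N = \<surd>N\<close> and \<open>\<beta> < 1/2\<close>, and \<open>L = 1\<close> for
\<open>A\<^sub>N = \<surd>(N ln N)\<close> and \<open>\<beta> = 1/2\<close>. Levy's continuity theorem concludes.

\<^bold>\<open>Almost sure limit.\<close> For \<open>\<beta> > 1/2\<close> the second moment of \<open>S\<^sub>n\<close> is at most of order \<open>n\<close> to the power
\<open>2 \<beta>\<close>, which
is the order of \<open>\<Pi>\<^sub>n\<^sup>2\<close>, so the martingale \<open>S\<^sub>n / \<Pi>\<^sub>n\<close> is bounded in \<open>L\<^sup>2\<close> and converges almost surely, by the maximal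
inequality \<open>martingale_maximal_inequality\<close>. If the limit were constant, all second moments of the
martingale would agree, which forces the mean of \<open>V\<^sub>n\<close> to equal that of \<open>(S\<^sub>n / (n + 1))\<^sup>2\<close> for all \<open>n\<close>;
the former tends to \<open>\<tau> > 0\<close>, the latter to \<open>0\<close>.\<close>

section \<open>Deterministic asymptotics\<close>

text \<open>The Stolz-Cesaro theorem. All weighted averages below, in particular the limiting variances, are
evaluated with it.\<close>

lemma stolz_cesaro:
  fixes x d :: "nat \<Rightarrow> real"
  assumes inc: "eventually (\<lambda>n. d n < d (Suc n)) sequentially"
    and lim: "filterlim d at_top sequentially"
    and ratio: "(\<lambda>n. (x (Suc n) - x n) / (d (Suc n) - d n)) \<longlonglongrightarrow> L"
  shows "(\<lambda>n. x n / d n) \<longlonglongrightarrow> L"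
proof (rule LIMSEQ_I)
  fix e :: real assume e: "e > 0"
  have "eventually (\<lambda>n. norm ((x (Suc n) - x n) / (d (Suc n) - d n) - L) < e/2) sequentially"
    using ratio e unfolding tendsto_iff dist_norm by (meson half_gt_zero)
  with inc have "eventually (\<lambda>n. \<bar>(x (Suc n) - L * d (Suc n)) - (x n - L * d n)\<bar> \<le> e/2 * (d (Suc n) - d n)) sequentially"
  proof eventually_elim
    case (elim n)
    define D where "D = d (Suc n) - d n"
    define Y where "Y = x (Suc n) - x n"
    have D: "D > 0" using elim by (simp add: D_def)
    have "\<bar>Y / D - L\<bar> < e/2" using elim by (simp add: D_def Y_def)
    hence "\<bar>Y / D - L\<bar> * D \<le> e/2 * D" using D by (intro mult_right_mono) auto
    moreover have "\<bar>Y / D - L\<bar> * D = \<bar>Y - L * D\<bar>"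
      using D by (metis abs_mult_pos abs_of_pos divide_eq_eq left_diff_distrib less_imp_le mult.commute nonzero_mult_div_cancel_left order_less_irrefl)
    ultimately show ?case by (simp add: D_def Y_def algebra_simps)
  qed
  then obtain N where N: "\<And>n. n \<ge> N \<Longrightarrow>
      \<bar>(x (Suc n) - L * d (Suc n)) - (x n - L * d n)\<bar> \<le> e/2 * (d (Suc n) - d n)"
    unfolding eventually_sequentially by blast
  have far: "\<bar>(x n - L * d n) - (x N - L * d N)\<bar> \<le> e/2 * (d n - d N)" if "n \<ge> N" for n
    using that
  proof (induction n rule: dec_induct)
    case (step n)
    have "\<bar>(x (Suc n) - L * d (Suc n)) - (x n - L * d n)\<bar> \<le> e/2 * (d (Suc n) - d n)"
      using N step by simp
    with step.IH have "\<bar>(x (Suc n) - L * d (Suc n)) - (x N - L * d N)\<bar> \<le> e/2 * (d (Suc n) - d n) + e/2 * (d n - d N)"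
      by linarith
    moreover have "e/2 * (d (Suc n) - d n) + e/2 * (d n - d N) = e/2 * (d (Suc n) - d N)"
      by (simp add: field_simps)
    ultimately show ?case by simp
  qed simp
  define B where "B = \<bar>x N - L * d N\<bar> + e/2 * \<bar>d N\<bar>"
  have "eventually (\<lambda>n. d n > max 0 (2 * B / e)) sequentially"
    using lim unfolding filterlim_at_top_dense by blast
  moreover have "eventually (\<lambda>n. n \<ge> N) sequentially" by (rule eventually_ge_at_top)
  ultimately have "eventually (\<lambda>n. norm (x n / d n - L) < e) sequentially"
  proof eventually_elim
    case (elim n)
    have dn: "d n > 0" and dB: "B < e/2 * d n" using elim e by (auto simp: field_simps)
    have "e/2 * (d n - d N) \<le> e/2 * d n + e/2 * \<bar>d N\<bar>"
      using e by (simp add: algebra_simps abs_if)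
    hence "\<bar>x n - L * d n\<bar> \<le> e/2 * d n + B"
      using far[OF elim(2)] unfolding B_def by linarith
    also have "\<dots> < e * d n" using dB by simp
    finally have "\<bar>x n - L * d n\<bar> / d n < e" using dn by (simp add: divide_less_eq)
    moreover have "x n / d n - L = (x n - L * d n) / d n" using dn by (simp add: field_simps)
    ultimately show ?case using dn by simp
  qed
  thus "\<exists>no. \<forall>n\<ge>no. norm (x n / d n - L) < e" by (simp add: eventually_sequentially)
qed

lemma Pi_norm_0 [simp]: "Pi_norm 0 b = 1"
  by (simp add: Pi_norm_def)

lemma Pi_norm_Suc: "Pi_norm (Suc n) b = Pi_norm n b * (1 + b / (real n + 1))"
  by (simp add: Pi_norm_def)

lemma Pi_norm_factor_pos: "b > -1 \<Longrightarrow> 1 + b / (real n + 1) > 0"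
  by (simp add: field_simps)

lemma Pi_norm_pos: "b > -1 \<Longrightarrow> Pi_norm n b > 0"
  unfolding Pi_norm_def by (intro prod_pos) (auto intro: Pi_norm_factor_pos)

text \<open>\<open>Pi_norm\<close> is increasing in its first argument for \<open>b \<ge> 0\<close> and decreasing for \<open>b \<le> 0\<close>; the bound
covers both cases. It gives uniform smallness of the increments in the central limit theorem.\<close>

lemma Pi_norm_ratio_le:
  assumes b: "b > -1" and kN: "k \<le> N"
  shows "Pi_norm N b / Pi_norm k b \<le> max 1 (Pi_norm N b)"
proof (cases "b \<ge> 0")
  case True
  have "1 \<le> Pi_norm k b" unfolding Pi_norm_def using True by (intro prod_ge_1) simp
  thus ?thesis using Pi_norm_pos[OF b, of N] by (simp add: divide_le_eq mult_left_le le_max_iff_disj)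
next
  case False
  have "Pi_norm N b \<le> Pi_norm k b" using kN
  proof (induction N rule: dec_induct)
    case (step n)
    have "Pi_norm (Suc n) b \<le> Pi_norm n b"
      using False Pi_norm_pos[OF b, of n] by (simp add: Pi_norm_Suc mult_left_le divide_le_0_iff)
    thus ?case using step by simp
  qed simp
  thus ?thesis using Pi_norm_pos[OF b, of k] by (simp add: divide_le_eq le_max_iff_disj)
qed

text \<open>The product is a quotient of a Pochhammer symbol and a factorial, so Euler's limit formula for the
Gamma function applies; the constant is \<open>1 / \<Gamma>(b + 1)\<close>.\<close>

lemma Pi_norm_asymptotics:
  assumes b: "b > -1"
  obtains c where "c > 0" "(\<lambda>n. Pi_norm n b / real n powr b) \<longlonglongrightarrow> c"
proof -
  have poch: "pochhammer (b + 1) n = Pi_norm n b * fact n" for n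
    by (induction n) (simp_all add: pochhammer_Suc Pi_norm_Suc field_simps)
  \<comment> \<open>\<open>rGamma_series (b + 1) n\<close> contains one factor more, \<open>b + 1 + n\<close>, and one more power of \<open>n\<close>.\<close>
  have "rGamma_series (b + 1) \<longlonglongrightarrow> rGamma (b + 1)" by (rule rGamma_series_LIMSEQ)
  moreover have "(\<lambda>n. real n / (real n + 1 + b)) \<longlonglongrightarrow> 1" by real_asymp
  ultimately have "(\<lambda>n. rGamma_series (b + 1) n * (real n / (real n + 1 + b))) \<longlonglongrightarrow> rGamma (b + 1) * 1"
    by (rule tendsto_mult)
  moreover have "eventually (\<lambda>n. rGamma_series (b + 1) n * (real n / (real n + 1 + b)) = Pi_norm n b / real n powr b) sequentially"
    using eventually_gt_at_top[of 0]
  proof eventually_elim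
    case (elim n)
    have "exp ((b + 1) * ln (real n)) = real n powr b * real n"
      using elim by (simp add: powr_def exp_add algebra_simps)
    hence "rGamma_series (b + 1) n = Pi_norm n b * (real n + 1 + b) / (real n powr b * real n)"
      using elim by (simp add: rGamma_series_def pochhammer_Suc poch)
    moreover have "real n + 1 + b > 0" using b by linarith
    ultimately show ?case using elim by simp
  qed
  ultimately have "(\<lambda>n. Pi_norm n b / real n powr b) \<longlonglongrightarrow> rGamma (b + 1)"
    using Lim_transform_eventually by fastforce
  moreover have "rGamma (b + 1) > 0"
    using Gamma_real_pos[of "b + 1"] b by (simp add: rGamma_inverse_Gamma)
  ultimately show ?thesis using that by blast
qed

text \<open>The sequence \<open>A m\<^sup>p - B m\<close> is a supersolution: Bernoulli's inequality \<open>1 + p / m \<le> (1 + 1 / m)\<^sup>p\<close> takes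
care of the first term, and the second one gains \<open>(p - 1) B\<close> in each step, which pays for \<open>K\<close>.\<close>

lemma recurrence_growth:
  fixes x :: "nat \<Rightarrow> real"
  assumes p: "1 < p" and K: "0 \<le> K" and nonneg: "\<And>n. 0 \<le> x n"
    and step: "\<And>n. x (Suc n) \<le> (1 + p / real (Suc n)) * x n + K"
  obtains A where "\<And>n. x n \<le> A * real (Suc n) powr p"
proof -
  \<comment> \<open>\<open>B\<close> absorbs \<open>K\<close> exactly, and \<open>A\<close> then fits the initial value.\<close>
  define B where "B = K / (p - 1)"
  define A where "A = x 0 + B"
  have B: "B \<ge> 0" "K = (p - 1) * B" using p K by (auto simp: B_def)
  have A: "A \<ge> 0" using B nonneg[of 0] by (simp add: A_def)
  have "x n \<le> A * real (Suc n) powr p - B * real (Suc n)" for n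
  proof (induction n)
    case 0
    thus ?case by (simp add: A_def)
  next
    case (Suc n)
    define m where "m = real (Suc n)"
    have m: "m > 0" by (simp add: m_def)
    have "1 + p / m \<le> (1 + 1 / m) powr p"
    proof -
      have "(1 + p / m) powr (1 / p) * 1 powr (1 - 1 / p) \<le> 1 / p * (1 + p / m) + (1 - 1 / p) * 1"
        using p m by (intro Youngs_inequality_0) (auto simp: add_pos_pos)
      also have "\<dots> = 1 + 1 / m" using p m by (simp add: field_simps)
      finally have "((1 + p / m) powr (1 / p)) powr p \<le> (1 + 1 / m) powr p"
        using p by (intro powr_mono2) auto
      thus ?thesis using p m by (simp add: powr_powr add_nonneg_nonneg)
    qed
    hence "(1 + p / m) * (A * m powr p) \<le> (1 + 1 / m) powr p * (A * m powr p)"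
      using A by (intro mult_right_mono) auto
    also have "\<dots> = A * ((1 + 1/m) * m) powr p"
      using m by (subst powr_mult) (auto simp: mult_ac)
    also have "(1 + 1/m) * m = m + 1" using m by (simp add: field_simps)
    finally have *: "(1 + p / m) * (A * m powr p) \<le> A * (m + 1) powr p" .
    have "x (Suc n) \<le> (1 + p / m) * x n + K" using step by (simp add: m_def)
    also have "\<dots> \<le> (1 + p / m) * (A * m powr p - B * m) + K"
      using Suc.IH p m unfolding m_def[symmetric] by (intro add_right_mono mult_left_mono) auto
    also have "\<dots> = (1 + p / m) * (A * m powr p) - B * m - p * B + (p - 1) * B"
      using m by (simp add: B(2)) (simp add: field_simps)
    also have "\<dots> \<le> A * (m + 1) powr p - B * (m + 1)"
      using * by (simp add: algebra_simps)
    finally show ?case by (simp add: m_def add_ac)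
  qed
  moreover have "A * real (Suc n) powr p - B * real (Suc n) \<le> A * real (Suc n) powr p" for n
    using B by simp
  ultimately show ?thesis using that order_trans by blast
qed

section \<open>The urn and the law of the next draw\<close>

context urn_process
begin

abbreviation past :: "nat \<Rightarrow> 'a measure" where
  "past n \<equiv> natural_filtration M C n"

lemma integrable_bounded:
  fixes f :: "'a \<Rightarrow> 'b::{banach, second_countable_topology}"
  assumes "f \<in> borel_measurable M" "\<And>\<omega>. \<omega> \<in> space M \<Longrightarrow> norm (f \<omega>) \<le> B"
  shows "integrable M f"
  using assms by (intro integrable_const_bound[where B = B]) auto

lemma urn_measurable [measurable]: "C n \<in> borel_measurable M"
proof (induction n)
  case 0
  have "C 0 \<in> borel_measurable M \<longleftrightarrow> (\<lambda>\<omega>. c0) \<in> borel_measurable M"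
    by (rule measurable_cong) (rule initial)
  thus ?case by simp
next
  case (Suc n)
  have "(\<lambda>\<omega>. row (X (Suc n) \<omega>) R) \<in> borel_measurable M"
    by (rule measurable_compose[OF measurable_draw]) simp
  hence "(\<lambda>\<omega>. C n \<omega> + row (X (Suc n) \<omega>) R) \<in> borel_measurable M"
    using Suc by measurable
  thus ?case by (subst measurable_cong[OF replacement])
qed

lemma urn_component_measurable [measurable]: "(\<lambda>\<omega>. C n \<omega> $ i) \<in> borel_measurable M"
  unfolding cart_eq_inner_axis using urn_measurable[of n] by measurable

lemma space_past [simp]: "space (past n) = space M"
  unfolding natural_filtration_def by (rule space_measure_of) auto

lemma sets_past: "sets (past n) =
    sigma_sets (space M) (\<Union>m\<in>{..n}. {C m -` A \<inter> space M |A. A \<in> sets borel})"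
  unfolding natural_filtration_def by (rule sets_measure_of) auto

lemma past_subalgebra: "subalgebra M (past n)"
  unfolding subalgebra_def sets_past
  by (auto intro!: sets.sigma_sets_subset measurable_sets[OF urn_measurable])

lemma past_mono: "m \<le> n \<Longrightarrow> sets (past m) \<subseteq> sets (past n)"
  unfolding sets_past by (intro sigma_sets_mono' UN_mono) auto

lemma urn_past_measurable: "m \<le> n \<Longrightarrow> C m \<in> borel_measurable (past n)"
  by (rule measurableI) (auto simp: sets_past)

lemma past_measurable_lift: "f \<in> borel_measurable (past n) \<Longrightarrow> f \<in> borel_measurable M"
  by (rule measurable_from_subalg[OF past_subalgebra])

lemma urn_inner_past_measurable:
  assumes "m \<le> n" shows "(\<lambda>\<omega>. C m \<omega> \<bullet> u) \<in> borel_measurable (past n)"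
  using urn_past_measurable[OF assms] by measurable

lemma past_sigma_finite: "sigma_finite_subalgebra M (past n)"
  by (intro finite_measure_subalgebra_is_sigma_finite)
    (simp add: finite_measure_subalgebra_def finite_measure_subalgebra_axioms_def past_subalgebra
      finite_measure_axioms)

lemma replacement_nonneg: "0 \<le> R $ i $ j"
  and replacement_row_sum: "(\<Sum>j\<in>UNIV. R $ i $ j) = 1"
  using stochastic_replacement
  by (auto simp: stochastic_matrix_def prob_vector_def row_def)

lemma urn_nonneg: "\<omega> \<in> space M \<Longrightarrow> 0 \<le> C n \<omega> $ i"
proof (induction n)
  case 0
  thus ?case using prob_vector_c0 by (simp add: initial prob_vector_def)
next
  case (Suc n)
  thus ?case by (simp add: replacement row_def replacement_nonneg)
qed

lemma urn_total: "\<omega> \<in> space M \<Longrightarrow> (\<Sum>i\<in>UNIV. C n \<omega> $ i) = real (Suc n)"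
proof (induction n)
  case 0
  thus ?case using prob_vector_c0 by (simp add: initial prob_vector_def)
next
  case (Suc n)
  thus ?case by (simp add: replacement row_def replacement_row_sum sum.distrib)
qed

lemma urn_inner_bound:
  assumes "\<omega> \<in> space M" "\<And>i. \<bar>u $ i\<bar> \<le> K"
  shows "\<bar>C n \<omega> \<bullet> u\<bar> \<le> K * real (Suc n)"
proof -
  have "\<bar>C n \<omega> \<bullet> u\<bar> \<le> (\<Sum>i\<in>UNIV. \<bar>C n \<omega> $ i * u $ i\<bar>)"
    unfolding inner_vec_def by (simp add: sum_abs)
  also have "\<dots> \<le> (\<Sum>i\<in>UNIV. C n \<omega> $ i * K)"
    using assms urn_nonneg by (intro sum_mono) (auto simp: abs_mult intro!: mult_left_mono)
  also have "\<dots> = K * real (Suc n)"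
    using urn_total[OF assms(1)] by (simp add: sum_distrib_right[symmetric])
  finally show ?thesis .
qed

lemma expectation_indicator_draw:
  assumes g: "g \<in> borel_measurable (past n)"
    and bound: "\<And>\<omega>. \<omega> \<in> space M \<Longrightarrow> \<bar>g \<omega>\<bar> \<le> B"
  shows "expectation (\<lambda>\<omega>. g \<omega> * indicator {i} (X (Suc n) \<omega>)) =
    expectation (\<lambda>\<omega>. g \<omega> * (C n \<omega> $ i / real (Suc n)))"
proof -
  interpret past: sigma_finite_subalgebra M "past n" by (rule past_sigma_finite)
  note [measurable] = past_measurable_lift[OF g] measurable_draw
  define A where "A = {\<omega> \<in> space M. X (Suc n) \<omega> = i}"
  have A [measurable]: "A \<in> sets M" unfolding A_def by measurable
  have "expectation (\<lambda>\<omega>. g \<omega> * indicator {i} (X (Suc n) \<omega>)) = expectation (\<lambda>\<omega>. g \<omega> * indicator A \<omega>)"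
    by (intro Bochner_Integration.integral_cong) (auto simp: A_def indicator_def)
  also have "\<dots> = expectation (\<lambda>\<omega>. g \<omega> * real_cond_exp M (past n) (indicator A) \<omega>)"
  proof (rule past.real_cond_exp_intg(2)[symmetric])
    show "integrable M (\<lambda>\<omega>. g \<omega> * indicator A \<omega>)"
    proof (rule integrable_bounded[where B = "\<bar>B\<bar>"])
      show "norm (g \<omega> * indicator A \<omega>) \<le> \<bar>B\<bar>" if "\<omega> \<in> space M" for \<omega>
        using bound[OF that] by (auto simp: indicator_def)
    qed measurable
  qed (use g in measurable)
  also have "\<dots> = expectation (\<lambda>\<omega>. g \<omega> * (C n \<omega> $ i / real (Suc n)))"
    using draw[of n i] unfolding A_def[symmetric]
    by (intro integral_cong_AE) auto
  finally show ?thesis .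
qed

lemma urn_component_le: "\<omega> \<in> space M \<Longrightarrow> C n \<omega> $ i / real (Suc n) \<le> 1"
  using member_le_sum[of i UNIV "\<lambda>i. C n \<omega> $ i"] urn_nonneg urn_total by (simp add: divide_le_eq)

text \<open>The defining property of the draw, transferred coordinatewise to random vectors, so that complex
exponentials of the past can serve as \<open>g\<close>.\<close>

lemma expectation_indicator_draw_vector:
  fixes g :: "'a \<Rightarrow> 'b::euclidean_space"
  assumes g: "g \<in> borel_measurable (past n)"
    and bound: "\<And>\<omega>. \<omega> \<in> space M \<Longrightarrow> norm (g \<omega>) \<le> B"
  shows "integrable M (\<lambda>\<omega>. indicator {i} (X (Suc n) \<omega>) *\<^sub>R g \<omega>)" (is ?int1)
    and "integrable M (\<lambda>\<omega>. (C n \<omega> $ i / real (Suc n)) *\<^sub>R g \<omega>)" (is ?int2)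
    and "(\<integral>\<omega>. indicator {i} (X (Suc n) \<omega>) *\<^sub>R g \<omega> \<partial>M) =
      (\<integral>\<omega>. (C n \<omega> $ i / real (Suc n)) *\<^sub>R g \<omega> \<partial>M)" (is ?eq)
proof -
  note [measurable] = past_measurable_lift[OF g]
  have [measurable]: "(\<lambda>\<omega>. indicator {i} (X (Suc n) \<omega>) :: real) \<in> borel_measurable M"
    by (rule measurable_compose[OF measurable_draw]) simp
  have [measurable]: "(\<lambda>\<omega>. C n \<omega> $ i / real (Suc n)) \<in> borel_measurable M"
    by (intro borel_measurable_divide urn_component_measurable) simp
  show int1: ?int1
  proof (rule integrable_bounded[where B = "\<bar>B\<bar>"])
    show "norm (indicator {i} (X (Suc n) \<omega>) *\<^sub>R g \<omega>) \<le> \<bar>B\<bar>" if "\<omega> \<in> space M" for \<omega>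
      using bound[OF that] by (auto simp: indicator_def)
  qed measurable
  show int2: ?int2
  proof (rule integrable_bounded[where B = "1 * \<bar>B\<bar>"])
    show "norm ((C n \<omega> $ i / real (Suc n)) *\<^sub>R g \<omega>) \<le> 1 * \<bar>B\<bar>" if "\<omega> \<in> space M" for \<omega>
      unfolding norm_scaleR
      using bound[OF that] urn_component_le[OF that, of n i] urn_nonneg[OF that, of n i]
      by (intro mult_mono) auto
  qed measurable
  show ?eq
  proof (rule euclidean_eqI)
    fix b :: 'b assume b: "b \<in> Basis"
    have gb: "(\<lambda>\<omega>. g \<omega> \<bullet> b) \<in> borel_measurable (past n)" using g by measurable
    have "\<bar>g \<omega> \<bullet> b\<bar> \<le> B" if "\<omega> \<in> space M" for \<omega>
      using bound[OF that] Basis_le_norm[OF b, of "g \<omega>"] by simp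
    from expectation_indicator_draw[OF gb this, of i]
    show "(\<integral>\<omega>. indicator {i} (X (Suc n) \<omega>) *\<^sub>R g \<omega> \<partial>M) \<bullet> b =
        (\<integral>\<omega>. (C n \<omega> $ i / real (Suc n)) *\<^sub>R g \<omega> \<partial>M) \<bullet> b"
      using int1 int2 by (simp flip: integral_inner_left add: mult.commute)
  qed
qed

lemma expectation_draw_algebra:
  fixes g :: "'a \<Rightarrow> 'b::{euclidean_space, real_normed_algebra}" and h :: "'k \<Rightarrow> 'b"
  assumes g: "g \<in> borel_measurable (past n)"
    and bound: "\<And>\<omega>. \<omega> \<in> space M \<Longrightarrow> norm (g \<omega>) \<le> B"
  shows "(\<integral>\<omega>. g \<omega> * h (X (Suc n) \<omega>) \<partial>M) =
    (\<integral>\<omega>. g \<omega> * (\<Sum>i\<in>UNIV. (C n \<omega> $ i / real (Suc n)) *\<^sub>R h i) \<partial>M)"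
proof -
  note ind = expectation_indicator_draw_vector[OF g bound]
  have "(\<integral>\<omega>. g \<omega> * h (X (Suc n) \<omega>) \<partial>M)
      = (\<integral>\<omega>. (\<Sum>i\<in>UNIV. (indicator {i} (X (Suc n) \<omega>) *\<^sub>R g \<omega>) * h i) \<partial>M)"
  proof (intro Bochner_Integration.integral_cong refl)
    fix \<omega>
    have "(\<Sum>i\<in>UNIV. (indicator {i} (X (Suc n) \<omega>) *\<^sub>R g \<omega>) * h i)
        = (\<Sum>i\<in>UNIV. if i = X (Suc n) \<omega> then g \<omega> * h i else 0)"
      by (intro sum.cong) (auto simp: indicator_def)
    thus "g \<omega> * h (X (Suc n) \<omega>) = (\<Sum>i\<in>UNIV. (indicator {i} (X (Suc n) \<omega>) *\<^sub>R g \<omega>) * h i)"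
      by simp
  qed
  also have "\<dots> = (\<Sum>i\<in>UNIV. (\<integral>\<omega>. indicator {i} (X (Suc n) \<omega>) *\<^sub>R g \<omega> \<partial>M) * h i)"
    using ind(1) by (subst Bochner_Integration.integral_sum) (auto simp del: mult_scaleR_left)
  also have "\<dots> = (\<Sum>i\<in>UNIV. (\<integral>\<omega>. (C n \<omega> $ i / real (Suc n)) *\<^sub>R g \<omega> \<partial>M) * h i)"
    by (simp only: ind(3))
  also have "\<dots> = (\<integral>\<omega>. (\<Sum>i\<in>UNIV. ((C n \<omega> $ i / real (Suc n)) *\<^sub>R g \<omega>) * h i) \<partial>M)"
    using ind(2) by (subst Bochner_Integration.integral_sum) (auto simp del: mult_scaleR_left)
  also have "\<dots> = (\<integral>\<omega>. g \<omega> * (\<Sum>i\<in>UNIV. (C n \<omega> $ i / real (Suc n)) *\<^sub>R h i) \<partial>M)"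
    by (simp add: sum_distrib_left)
  finally show ?thesis .
qed

lemma expectation_draw:
  fixes h :: "real ^ 'k"
  assumes g: "g \<in> borel_measurable (past n)"
    and bound: "\<And>\<omega>. \<omega> \<in> space M \<Longrightarrow> \<bar>g \<omega>\<bar> \<le> B"
  shows "expectation (\<lambda>\<omega>. g \<omega> * h $ X (Suc n) \<omega>) =
    expectation (\<lambda>\<omega>. g \<omega> * (C n \<omega> \<bullet> h)) / real (Suc n)"
proof -
  have "expectation (\<lambda>\<omega>. g \<omega> * h $ X (Suc n) \<omega>) =
      expectation (\<lambda>\<omega>. g \<omega> * (\<Sum>i\<in>UNIV. (C n \<omega> $ i / real (Suc n)) *\<^sub>R h $ i))"
    using bound by (intro expectation_draw_algebra[OF g, of B]) simp
  also have "\<dots> = expectation (\<lambda>\<omega>. g \<omega> * (C n \<omega> \<bullet> h) / real (Suc n))"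
    by (intro Bochner_Integration.integral_cong refl)
      (simp add: inner_vec_def sum_distrib_left sum_divide_distrib mult_ac)
  finally show ?thesis by simp
qed

end

section \<open>Moments along eigenvectors and the law of large numbers\<close>

context urn_process
begin

lemma urn_inner_measurable [measurable]: "(\<lambda>\<omega>. C n \<omega> \<bullet> u) \<in> borel_measurable M"
  using urn_measurable[of n] by measurable

lemma draw_component_measurable [measurable]: "(\<lambda>\<omega>. h (X n \<omega>)) \<in> borel_measurable M"
  for h :: "'k \<Rightarrow> 'b::topological_space"
  by (rule measurable_compose[OF measurable_draw]) simp

lemma urn_inner_norm_bound: "\<omega> \<in> space M \<Longrightarrow> \<bar>C n \<omega> \<bullet> u\<bar> \<le> norm u * real (Suc n)"
  by (rule urn_inner_bound) (auto simp: component_le_norm_cart)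

lemma integrable_urn_inner: "integrable M (\<lambda>\<omega>. C n \<omega> \<bullet> u)"
  using urn_inner_norm_bound by (intro integrable_bounded[where B = "norm u * real (Suc n)"]) auto

lemma integrable_urn_inner_square: "integrable M (\<lambda>\<omega>. (C n \<omega> \<bullet> u)\<^sup>2)"
proof (rule integrable_bounded[where B = "(norm u * real (Suc n))\<^sup>2"])
  show "norm ((C n \<omega> \<bullet> u)\<^sup>2) \<le> (norm u * real (Suc n))\<^sup>2" if "\<omega> \<in> space M" for \<omega>
    using power_mono[OF urn_inner_norm_bound[OF that, of n u] abs_ge_zero, of 2] by simp
qed measurable

lemma eigenvector_step:
  assumes "R *v u = \<mu> *\<^sub>R u" "\<omega> \<in> space M"
  shows "C (Suc n) \<omega> \<bullet> u = C n \<omega> \<bullet> u + \<mu> * u $ X (Suc n) \<omega>"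
proof -
  have "row i R \<bullet> u = \<mu> * u $ i" for i
    using arg_cong[OF assms(1), of "\<lambda>x. x $ i"]
    by (simp add: matrix_vector_mult_def row_def inner_vec_def)
  thus ?thesis using assms(2) by (simp add: replacement inner_add_left)
qed

text \<open>The increment \<open>\<mu> u\<^sub>X\<close> is correlated with the past through its conditional mean; this produces the factor
\<open>1 + 2 \<mu> / (n + 1)\<close>.\<close>

lemma second_moment_step:
  assumes eig: "R *v u = \<mu> *\<^sub>R u"
  shows "expectation (\<lambda>\<omega>. (C (Suc n) \<omega> \<bullet> u)\<^sup>2) =
    (1 + 2 * \<mu> / real (Suc n)) * expectation (\<lambda>\<omega>. (C n \<omega> \<bullet> u)\<^sup>2)
    + \<mu>\<^sup>2 * (expectation (\<lambda>\<omega>. C n \<omega> \<bullet> square_vec u) / real (Suc n))"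
proof -
  let ?S = "\<lambda>\<omega>. C n \<omega> \<bullet> u" and ?u = "\<lambda>\<omega>. u $ X (Suc n) \<omega>"
  have u_bound: "\<bar>?u \<omega>\<bar> \<le> norm u" for \<omega> by (rule component_le_norm_cart)
  have int1: "integrable M (\<lambda>\<omega>. ?S \<omega> * ?u \<omega>)"
  proof (rule integrable_bounded)
    show "norm (?S \<omega> * ?u \<omega>) \<le> (norm u * real (Suc n)) * norm u" if "\<omega> \<in> space M" for \<omega>
      unfolding norm_mult
      using urn_inner_norm_bound[OF that, of n u] u_bound[of \<omega>] by (intro mult_mono) auto
  qed (use draw_component_measurable[of "\<lambda>i. u $ i"] in measurable)
  have int2: "integrable M (\<lambda>\<omega>. (?u \<omega>)\<^sup>2)"
  proof (rule integrable_bounded)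
    show "norm ((?u \<omega>)\<^sup>2) \<le> (norm u)\<^sup>2" for \<omega>
      using power_mono[OF u_bound abs_ge_zero, where n = 2] by simp
  qed (use draw_component_measurable[of "\<lambda>i. u $ i"] in measurable)
  have cross: "expectation (\<lambda>\<omega>. ?S \<omega> * ?u \<omega>) = expectation (\<lambda>\<omega>. (?S \<omega>)\<^sup>2) / real (Suc n)"
    using expectation_draw[OF urn_inner_past_measurable[of n n u] urn_inner_norm_bound, of u]
    by (simp add: power2_eq_square)
  have diag: "expectation (\<lambda>\<omega>. (?u \<omega>)\<^sup>2) = expectation (\<lambda>\<omega>. C n \<omega> \<bullet> square_vec u) / real (Suc n)"
    using expectation_draw[of "\<lambda>_. 1" n 1 "square_vec u"] by (simp add: square_vec_def)
  have "expectation (\<lambda>\<omega>. (C (Suc n) \<omega> \<bullet> u)\<^sup>2)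
      = expectation (\<lambda>\<omega>. (?S \<omega>)\<^sup>2 + 2 * \<mu> * (?S \<omega> * ?u \<omega>) + \<mu>\<^sup>2 * (?u \<omega>)\<^sup>2)"
    by (intro Bochner_Integration.integral_cong refl)
      (simp add: eigenvector_step[OF eig] power2_eq_square algebra_simps)
  also have "\<dots> = expectation (\<lambda>\<omega>. (?S \<omega>)\<^sup>2) + 2 * \<mu> * expectation (\<lambda>\<omega>. ?S \<omega> * ?u \<omega>)
      + \<mu>\<^sup>2 * expectation (\<lambda>\<omega>. (?u \<omega>)\<^sup>2)"
    using int1 int2 integrable_urn_inner_square[of n u] by simp
  finally show ?thesis by (simp add: cross diag algebra_simps)
qed

lemma expectation_square_vec_bound:
  "expectation (\<lambda>\<omega>. C n \<omega> \<bullet> square_vec u) / real (Suc n) \<le> norm (square_vec u)"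
proof -
  have "expectation (\<lambda>\<omega>. C n \<omega> \<bullet> square_vec u) \<le> expectation (\<lambda>\<omega>. norm (square_vec u) * real (Suc n))"
    using urn_inner_norm_bound[of _ n "square_vec u"]
    by (intro integral_mono integrable_urn_inner) (auto simp: abs_le_iff)
  thus ?thesis by (simp add: prob_space divide_le_eq)
qed

text \<open>Nonnegativity of the second moment allows the exponent \<open>2 \<mu>\<close> to be replaced by a larger \<open>p\<close>. The
requirement \<open>1 < p\<close> makes the noise term negligible against the growth.\<close>

lemma second_moment_growth:
  assumes eig: "R *v u = \<mu> *\<^sub>R u" and p: "1 < p" "2 * \<mu> \<le> p"
  obtains A where "\<And>n. expectation (\<lambda>\<omega>. (C n \<omega> \<bullet> u)\<^sup>2) \<le> A * real (Suc n) powr p"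
proof (rule recurrence_growth[OF p(1), of "\<mu>\<^sup>2 * norm (square_vec u)" "\<lambda>n. expectation (\<lambda>\<omega>. (C n \<omega> \<bullet> u)\<^sup>2)"])
  fix n
  have "(1 + 2 * \<mu> / real (Suc n)) * expectation (\<lambda>\<omega>. (C n \<omega> \<bullet> u)\<^sup>2)
      \<le> (1 + p / real (Suc n)) * expectation (\<lambda>\<omega>. (C n \<omega> \<bullet> u)\<^sup>2)"
    using p by (intro mult_right_mono add_left_mono divide_right_mono) auto
  moreover have "\<mu>\<^sup>2 * (expectation (\<lambda>\<omega>. C n \<omega> \<bullet> square_vec u) / real (Suc n))
      \<le> \<mu>\<^sup>2 * norm (square_vec u)"
    using expectation_square_vec_bound by (intro mult_left_mono) auto
  ultimately show "expectation (\<lambda>\<omega>. (C (Suc n) \<omega> \<bullet> u)\<^sup>2)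
      \<le> (1 + p / real (Suc n)) * expectation (\<lambda>\<omega>. (C n \<omega> \<bullet> u)\<^sup>2) + \<mu>\<^sup>2 * norm (square_vec u)"
    unfolding second_moment_step[OF eig] by linarith
qed (use that in auto)

text \<open>An exponent \<open>p\<close> strictly between 1 and 2 that is at least \<open>2 \<mu>\<close> exists precisely because \<open>\<mu> < 1\<close>.\<close>

lemma second_moment_negligible:
  assumes eig: "R *v u = \<mu> *\<^sub>R u" and \<mu>: "\<mu> < 1"
  shows "(\<lambda>n. expectation (\<lambda>\<omega>. (C n \<omega> \<bullet> u / real (Suc n))\<^sup>2)) \<longlonglongrightarrow> 0"
proof -
  define p where "p = max (2 * \<mu>) (3/2)"
  have p: "1 < p" "2 * \<mu> \<le> p" "p < 2" using \<mu> by (auto simp: p_def)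
  obtain A where A: "\<And>n. expectation (\<lambda>\<omega>. (C n \<omega> \<bullet> u)\<^sup>2) \<le> A * real (Suc n) powr p"
    using second_moment_growth[OF eig p(1,2)] by blast
  have eq: "expectation (\<lambda>\<omega>. (C n \<omega> \<bullet> u / real (Suc n))\<^sup>2)
      = expectation (\<lambda>\<omega>. (C n \<omega> \<bullet> u)\<^sup>2) / (real (Suc n))\<^sup>2" for n
    by (simp add: power_divide del: of_nat_Suc)
  show ?thesis
  proof (rule tendsto_sandwich[OF _ _ tendsto_const])
    show "(\<lambda>n. A * (real (Suc n) powr p / (real (Suc n))\<^sup>2)) \<longlonglongrightarrow> 0"
    proof (rule tendsto_mult_right_zero)
      have "(\<lambda>n. real (Suc n) powr (p - 2)) \<longlonglongrightarrow> 0"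
        using p by real_asymp
      moreover have "real (Suc n) powr (p - 2) = real (Suc n) powr p / (real (Suc n))\<^sup>2" for n
        by (simp add: powr_diff del: of_nat_Suc)
      ultimately show "(\<lambda>n. real (Suc n) powr p / (real (Suc n))\<^sup>2) \<longlonglongrightarrow> 0" by simp
    qed
    show "\<forall>\<^sub>F n in sequentially. expectation (\<lambda>\<omega>. (C n \<omega> \<bullet> u / real (Suc n))\<^sup>2)
        \<le> A * (real (Suc n) powr p / (real (Suc n))\<^sup>2)"
      unfolding eq using A by (intro always_eventually allI) (simp add: divide_right_mono del: of_nat_Suc)
  qed (auto simp: eq)
qed

text \<open>The variance of \<open>\<bar>f\<bar>\<close> is nonnegative.\<close>

lemma expectation_abs_le_sqrt:
  assumes "integrable M f" "integrable M (\<lambda>\<omega>. (f \<omega>)\<^sup>2)"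
  shows "expectation (\<lambda>\<omega>. \<bar>f \<omega>\<bar>) \<le> sqrt (expectation (\<lambda>\<omega>. (f \<omega>)\<^sup>2))"
proof (rule real_le_rsqrt)
  have "0 \<le> variance (\<lambda>\<omega>. \<bar>f \<omega>\<bar>)" by (rule variance_positive)
  thus "(expectation (\<lambda>\<omega>. \<bar>f \<omega>\<bar>))\<^sup>2 \<le> expectation (\<lambda>\<omega>. (f \<omega>)\<^sup>2)"
    using assms by (subst (asm) variance_eq) auto
qed

lemma first_moment_negligible:
  assumes eig: "R *v u = \<mu> *\<^sub>R u" and \<mu>: "\<mu> < 1"
  shows "(\<lambda>n. expectation (\<lambda>\<omega>. \<bar>C n \<omega> \<bullet> u / real (Suc n)\<bar>)) \<longlonglongrightarrow> 0"
proof (rule tendsto_sandwich[OF _ _ tendsto_const])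
  show "(\<lambda>n. sqrt (expectation (\<lambda>\<omega>. (C n \<omega> \<bullet> u / real (Suc n))\<^sup>2))) \<longlonglongrightarrow> 0"
    using tendsto_real_sqrt[OF second_moment_negligible[OF assms]] by simp
  show "\<forall>\<^sub>F n in sequentially. expectation (\<lambda>\<omega>. \<bar>C n \<omega> \<bullet> u / real (Suc n)\<bar>)
      \<le> sqrt (expectation (\<lambda>\<omega>. (C n \<omega> \<bullet> u / real (Suc n))\<^sup>2))"
    using integrable_urn_inner integrable_urn_inner_square
    by (intro always_eventually allI expectation_abs_le_sqrt) (auto simp: power_divide)
qed auto

text \<open>The constant part \<open>a\<close> of \<open>w\<close> is counted exactly, since the urn holds \<open>n + 1\<close> balls after \<open>n\<close> trials;
the eigenvectors with eigenvalue below 1 contribute only errors that vanish in mean.\<close>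

lemma law_of_large_numbers:
  fixes e :: "'i \<Rightarrow> real ^ 'k" and \<mu> :: "'i \<Rightarrow> real"
  assumes I: "finite I"
    and eig: "\<And>i. i \<in> I \<Longrightarrow> R *v e i = \<mu> i *\<^sub>R e i" "\<And>i. i \<in> I \<Longrightarrow> \<mu> i < 1"
    and w: "w = vec a + (\<Sum>i\<in>I. e i)"
  shows "(\<lambda>n. expectation (\<lambda>\<omega>. \<bar>C n \<omega> \<bullet> w / real (Suc n) - a\<bar>)) \<longlonglongrightarrow> 0"
proof (rule tendsto_sandwich[OF _ _ tendsto_const])
  show "(\<lambda>n. \<Sum>i\<in>I. expectation (\<lambda>\<omega>. \<bar>C n \<omega> \<bullet> e i / real (Suc n)\<bar>)) \<longlonglongrightarrow> 0"
    using eig by (intro tendsto_null_sum first_moment_negligible)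
  have "expectation (\<lambda>\<omega>. \<bar>C n \<omega> \<bullet> w / real (Suc n) - a\<bar>)
      \<le> (\<Sum>i\<in>I. expectation (\<lambda>\<omega>. \<bar>C n \<omega> \<bullet> e i / real (Suc n)\<bar>))" for n
  proof -
    have "expectation (\<lambda>\<omega>. \<bar>C n \<omega> \<bullet> w / real (Suc n) - a\<bar>)
        \<le> expectation (\<lambda>\<omega>. \<Sum>i\<in>I. \<bar>C n \<omega> \<bullet> e i / real (Suc n)\<bar>)"
    proof (intro integral_mono)
      fix \<omega> assume \<omega>: "\<omega> \<in> space M"
      have "C n \<omega> \<bullet> vec a = a * real (Suc n)"
        using urn_total[OF \<omega>, of n] by (simp add: inner_vec_def sum_distrib_right[symmetric])
      hence "C n \<omega> \<bullet> w / real (Suc n) - a = (\<Sum>i\<in>I. C n \<omega> \<bullet> e i / real (Suc n))"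
        unfolding w by (simp add: inner_add_right inner_sum_right add_divide_distrib sum_divide_distrib
            del: of_nat_Suc)
      thus "\<bar>C n \<omega> \<bullet> w / real (Suc n) - a\<bar> \<le> (\<Sum>i\<in>I. \<bar>C n \<omega> \<bullet> e i / real (Suc n)\<bar>)"
        by (simp only: sum_abs)
    qed (use integrable_urn_inner in auto)
    also have "\<dots> = (\<Sum>i\<in>I. expectation (\<lambda>\<omega>. \<bar>C n \<omega> \<bullet> e i / real (Suc n)\<bar>))"
      using integrable_urn_inner by (subst Bochner_Integration.integral_sum) auto
    finally show ?thesis .
  qed
  thus "\<forall>\<^sub>F n in sequentially. expectation (\<lambda>\<omega>. \<bar>C n \<omega> \<bullet> w / real (Suc n) - a\<bar>)
      \<le> (\<Sum>i\<in>I. expectation (\<lambda>\<omega>. \<bar>C n \<omega> \<bullet> e i / real (Suc n)\<bar>))" by simp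
qed auto

end

section \<open>Characteristic functions and the central limit theorem\<close>

text \<open>For the upper bound, \<open>1 - a + a\<^sup>2 / 2\<close> times the Taylor polynomial \<open>1 + a + a\<^sup>2 / 2 \<le> exp a\<close> is at
least 1.\<close>

lemma exp_minus_linear_bound:
  fixes a :: real
  assumes "0 \<le> a" shows "\<bar>exp (- a) - (1 - a)\<bar> \<le> a\<^sup>2 / 2"
proof -
  have q: "1 + a + a\<^sup>2 / 2 \<le> exp a" using assms by (rule exp_lower_Taylor_quadratic)
  have "(1 - a + a\<^sup>2 / 2) * (1 + a + a\<^sup>2 / 2) = 1 + a ^ 4 / 4"
    by (simp add: algebra_simps power2_eq_square power4_eq_xxxx)
  hence "1 \<le> (1 - a + a\<^sup>2 / 2) * (1 + a + a\<^sup>2 / 2)" by simp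
  also have "0 \<le> 1 - a + a\<^sup>2 / 2" using sum_squares_ge_zero[of "1 - a" 1]
    by (simp add: power2_eq_square algebra_simps)
  hence "(1 - a + a\<^sup>2 / 2) * (1 + a + a\<^sup>2 / 2) \<le> (1 - a + a\<^sup>2 / 2) * exp a"
    using q by (rule mult_left_mono[rotated])
  finally have "exp (- a) \<le> 1 - a + a\<^sup>2 / 2" by (simp add: exp_minus divide_simps)
  moreover have "1 - a \<le> exp (- a)" using exp_ge_add_one_self[of "- a"] by simp
  ultimately show ?thesis by simp
qed

lemma iexp_approx_linear: "cmod (iexp x - (1 + \<i> * of_real x)) \<le> x\<^sup>2 / 2"
  using iexp_approx1[of x 1] by (simp add: power2_eq_square)

lemma iexp_approx_quadratic: "cmod (iexp x - (1 + \<i> * of_real x - (of_real x)\<^sup>2 / 2)) \<le> \<bar>x\<bar> ^ 3 / 6"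
proof -
  have "{..2::nat} = {0, 1, 2}" by auto
  thus ?thesis using iexp_approx1[of x 2]
    by (simp add: fact_numeral power_mult_distrib algebra_simps numeral_3_eq_3)
qed

text \<open>One step of the central limit theorem. The left-hand sum is the characteristic function of a small
jump \<open>x\<close> with law \<open>p\<close>. To second order it agrees with the factor \<open>iexp m\<close> of its mean \<open>m\<close> times the
Gaussian factor \<open>exp (- a)\<close>, as soon as the second moment is close to \<open>2 a\<close> and the mean is small.\<close>

lemma weighted_iexp_approx:
  fixes p x :: "'i::finite \<Rightarrow> real"
  assumes p: "\<And>i. 0 \<le> p i" "(\<Sum>i\<in>UNIV. p i) = 1"
    and x: "\<And>i. \<bar>x i\<bar> \<le> B" and a: "0 \<le> a"
  shows "cmod ((\<Sum>i\<in>UNIV. p i *\<^sub>R iexp (x i)) - iexp (\<Sum>i\<in>UNIV. p i * x i) * of_real (exp (- a)))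
    \<le> \<bar>(\<Sum>i\<in>UNIV. p i * (x i)\<^sup>2) - 2 * a\<bar> / 2 + (\<Sum>i\<in>UNIV. p i * x i)\<^sup>2 / 2
      + B ^ 3 / 6 + a * B + a\<^sup>2 / 2"
proof -
  define m where "m = (\<Sum>i\<in>UNIV. p i * x i)"
  define q where "q = (\<Sum>i\<in>UNIV. p i * (x i)\<^sup>2)"
  have avg: "\<bar>\<Sum>i\<in>UNIV. p i * z i\<bar> \<le> b" if "\<And>i. \<bar>z i\<bar> \<le> b" for z b
  proof -
    have "\<bar>\<Sum>i\<in>UNIV. p i * z i\<bar> \<le> (\<Sum>i\<in>UNIV. p i * b)"
      using p that by (intro order.trans[OF sum_abs] sum_mono) (auto simp: abs_mult intro!: mult_left_mono)
    thus ?thesis using p by (simp add: sum_distrib_right[symmetric])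
  qed
  have m: "\<bar>m\<bar> \<le> B" unfolding m_def by (rule avg[OF x])
  have "cmod ((\<Sum>i\<in>UNIV. p i *\<^sub>R iexp (x i)) - (\<Sum>i\<in>UNIV. p i *\<^sub>R (1 + \<i> * of_real (x i) - (of_real (x i))\<^sup>2 / 2)))
      \<le> (\<Sum>i\<in>UNIV. p i * (B ^ 3 / 6))"
    unfolding sum_subtractf[symmetric] scaleR_diff_right[symmetric]
  proof (intro order.trans[OF norm_sum] sum_mono)
    fix i
    have "\<bar>x i\<bar> ^ 3 \<le> B ^ 3" using x by (intro power_mono) auto
    hence "cmod (iexp (x i) - (1 + \<i> * of_real (x i) - (of_real (x i))\<^sup>2 / 2)) \<le> B ^ 3 / 6"
      using iexp_approx_quadratic[of "x i"] by linarith
    thus "norm (p i *\<^sub>R (iexp (x i) - (1 + \<i> * of_real (x i) - (of_real (x i))\<^sup>2 / 2))) \<le> p i * (B ^ 3 / 6)"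
      using mult_left_mono[OF _ p(1)[of i]] p(1)[of i] by (simp only: norm_scaleR abs_of_nonneg)
  qed
  also have "(\<Sum>i\<in>UNIV. p i * (B ^ 3 / 6)) = B ^ 3 / 6"
    using p by (simp add: sum_distrib_right[symmetric] sum_divide_distrib[symmetric])
  also have "(\<Sum>i\<in>UNIV. p i *\<^sub>R (1 + \<i> * of_real (x i) - (of_real (x i))\<^sup>2 / 2))
      = of_real (\<Sum>i\<in>UNIV. p i) + \<i> * of_real m - of_real q / 2"
    unfolding m_def q_def of_real_sum
    by (simp add: scaleR_conv_of_real algebra_simps sum.distrib sum_subtractf sum_distrib_left sum_divide_distrib)
  finally have 1: "cmod ((\<Sum>i\<in>UNIV. p i *\<^sub>R iexp (x i)) - (1 + \<i> * of_real m - of_real q / 2)) \<le> B ^ 3 / 6"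
    using p by simp
  have 2: "cmod (iexp m - (1 + \<i> * of_real m)) \<le> m\<^sup>2 / 2" by (rule iexp_approx_linear)
  have "cmod (iexp m - 1) \<le> \<bar>m\<bar>" using iexp_approx1[of m 0] by simp
  hence 3: "cmod (of_real a * (iexp m - 1)) \<le> a * B"
    unfolding norm_mult using m a by (intro mult_mono) auto
  have "cmod (iexp m * of_real (exp (- a) - (1 - a))) = \<bar>exp (- a) - (1 - a)\<bar>"
    by (simp only: norm_mult norm_exp_i_times norm_of_real mult_1)
  hence 4: "cmod (iexp m * of_real (exp (- a) - (1 - a))) \<le> a\<^sup>2 / 2"
    using exp_minus_linear_bound[OF a] by simp
  have 5: "cmod (of_real ((2 * a - q) / 2)) \<le> \<bar>q - 2 * a\<bar> / 2" 
    unfolding norm_of_real by simp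
  have eq: "(\<Sum>i\<in>UNIV. p i *\<^sub>R iexp (x i)) - iexp m * of_real (exp (- a))
      = ((\<Sum>i\<in>UNIV. p i *\<^sub>R iexp (x i)) - (1 + \<i> * of_real m - of_real q / 2))
      - (iexp m - (1 + \<i> * of_real m)) + of_real a * (iexp m - 1)
      - iexp m * of_real (exp (- a) - (1 - a)) + of_real ((2 * a - q) / 2)"
    by (simp add: algebra_simps diff_divide_distrib)
  have tri: "cmod (z1 - z2 + z3 - z4 + z5) \<le> cmod z1 + cmod z2 + cmod z3 + cmod z4 + cmod z5" for z1 z2 z3 z4 z5
    using norm_triangle_ineq[of "z1 - z2 + z3 - z4" z5] norm_triangle_ineq4[of "z1 - z2 + z3" z4]
      norm_triangle_ineq[of "z1 - z2" z3] norm_triangle_ineq4[of z1 z2] by linarith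
  have "cmod ((\<Sum>i\<in>UNIV. p i *\<^sub>R iexp (x i)) - iexp m * of_real (exp (- a)))
      \<le> B ^ 3 / 6 + m\<^sup>2 / 2 + a * B + a\<^sup>2 / 2 + \<bar>q - 2 * a\<bar> / 2"
    unfolding eq using 1 2 3 4 5 by (rule order.trans[OF tri, OF add_mono[OF add_mono[OF add_mono[OF add_mono]]]])
  thus ?thesis unfolding m_def q_def by simp
qed

lemma real_distribution_normal_law:
  assumes "0 \<le> v" shows "real_distribution (normal_law m v)"
proof (cases "v = 0")
  case True
  thus ?thesis unfolding normal_law_def real_distribution_def real_distribution_axioms_def
    by (simp add: prob_space_return)
next
  case False
  thus ?thesis using assms unfolding normal_law_def real_distribution_def real_distribution_axioms_def
    by (simp add: prob_space_normal_density)
qed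

text \<open>The case \<open>v > 0\<close> reduces to the standard normal law by the substitution \<open>x = s y\<close> with \<open>s = \<surd>v\<close>.\<close>

lemma char_normal_law:
  assumes v: "0 \<le> v"
  shows "char (normal_law 0 v) t = of_real (exp (- (v * t\<^sup>2 / 2)))"
proof (cases "v = 0")
  case True
  have "(\<integral>x. iexp (t * x) \<partial>return borel 0) = iexp (t * 0)"
    by (rule integral_return) auto
  thus ?thesis using True by (simp add: normal_law_def char_def)
next
  case False
  define s where "s = sqrt v"
  have s: "s > 0" "s\<^sup>2 = v" using v False by (auto simp: s_def)
  have scale: "normal_density 0 s (0 + s * y) = std_normal_density y / s" for y
    using s unfolding normal_density_def
    by (simp add: power_mult_distrib real_sqrt_mult s_def[symmetric] False)
  have "char (normal_law 0 v) t = (\<integral>x. iexp (t * x) \<partial>density lborel (normal_density 0 s))"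
    using False by (simp add: normal_law_def char_def s_def)
  also have "\<dots> = (\<integral>x. normal_density 0 s x *\<^sub>R iexp (t * x) \<partial>lborel)"
    by (rule integral_density) auto
  also have "\<dots> = \<bar>s\<bar> *\<^sub>R (\<integral>y. normal_density 0 s (0 + s * y) *\<^sub>R iexp (t * (0 + s * y)) \<partial>lborel)"
    using s by (intro lborel_integral_real_affine) auto
  also have "\<dots> = (\<integral>y. s *\<^sub>R (normal_density 0 s (0 + s * y) *\<^sub>R iexp (t * (0 + s * y))) \<partial>lborel)"
    using s by (simp only: abs_of_pos integral_scaleR_right)
  also have "\<dots> = (\<integral>y. std_normal_density y *\<^sub>R iexp ((t * s) * y) \<partial>lborel)"
    unfolding scale using s by (intro Bochner_Integration.integral_cong refl) (simp add: mult_ac)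
  also have "\<dots> = char std_normal_distribution (t * s)"
    unfolding char_def by (rule integral_density[symmetric]) auto
  also have "\<dots> = of_real (exp (- (v * t\<^sup>2 / 2)))"
    using s by (simp add: char_std_normal_distribution power_mult_distrib mult.commute)
  finally show ?thesis .
qed

text \<open>The arguments \<open>r / \<Pi>\<^sub>k\<close> are chosen so that passing from \<open>k\<close> to \<open>k + 1\<close> cancels the dilation
\<open>1 + b / (k + 1)\<close>. The Gaussian factors have modulus at most 1, so the errors simply add up.\<close>

lemma char_recursion_telescope:
  fixes f :: "nat \<Rightarrow> real \<Rightarrow> complex"
  assumes b: "b > -1" and c: "c \<ge> 0"
    and step: "\<And>n \<theta>. cmod (f (Suc n) \<theta> - of_real (exp (- (c * \<theta>\<^sup>2))) * f n (\<theta> * (1 + b / real (Suc n))))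
      \<le> e n \<theta>"
  shows "cmod (f N (r / Pi_norm N b)
      - of_real (exp (- (c * (\<Sum>k<N. (r / Pi_norm (Suc k) b)\<^sup>2)))) * f 0 r)
    \<le> (\<Sum>k<N. e k (r / Pi_norm (Suc k) b))"
proof (induction N)
  case (Suc n)
  define \<theta> where "\<theta> = r / Pi_norm (Suc n) b"
  define E where "E = (\<Sum>k<n. (r / Pi_norm (Suc k) b)\<^sup>2)"
  have \<theta>: "\<theta> * (1 + b / real (Suc n)) = r / Pi_norm n b"
    using Pi_norm_factor_pos[OF b, of n] by (simp add: \<theta>_def Pi_norm_Suc add.commute)
  define z where "z = of_real (exp (- (c * \<theta>\<^sup>2))) * (f n (r / Pi_norm n b) - of_real (exp (- (c * E))) * f 0 r)"
  have "cmod z = exp (- (c * \<theta>\<^sup>2)) * cmod (f n (r / Pi_norm n b) - of_real (exp (- (c * E))) * f 0 r)"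
    by (simp add: z_def norm_mult)
  also have "\<dots> \<le> 1 * cmod (f n (r / Pi_norm n b) - of_real (exp (- (c * E))) * f 0 r)"
    using c by (intro mult_right_mono) auto
  finally have z: "cmod z \<le> (\<Sum>k<n. e k (r / Pi_norm (Suc k) b))"
    using Suc.IH by (simp add: E_def)
  have "f (Suc n) \<theta> - of_real (exp (- (c * (E + \<theta>\<^sup>2)))) * f 0 r
      = (f (Suc n) \<theta> - of_real (exp (- (c * \<theta>\<^sup>2))) * f n (r / Pi_norm n b)) + z"
    by (simp add: z_def algebra_simps exp_add exp_minus exp_diff divide_inverse)
  hence "cmod (f (Suc n) \<theta> - of_real (exp (- (c * (E + \<theta>\<^sup>2)))) * f 0 r)
      \<le> e n \<theta> + (\<Sum>k<n. e k (r / Pi_norm (Suc k) b))"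
    using step[of n \<theta>] z unfolding \<theta> by (simp only: order.trans[OF norm_triangle_ineq add_mono])
  thus ?case by (simp add: E_def \<theta>_def add.commute)
qed simp

text \<open>Conditionally on the past, the increment times \<open>\<theta>\<close> is the jump of \<open>weighted_iexp_approx\<close>. Its mean
\<open>\<theta> \<mu> S\<^sub>n / (n + 1)\<close> merges with \<open>\<theta> S\<^sub>n\<close> into a dilation of the argument. The two terms of \<open>\<epsilon>\<close> are the
deviation of the conditional second moment from its limit \<open>\<tau>\<close>, and the squared conditional mean.\<close>

lemma (in urn_process) char_step:
  assumes eig: "R *v u = \<mu> *\<^sub>R u" and \<tau>: "0 \<le> \<tau>"
  defines "f \<equiv> \<lambda>n \<theta>. \<integral>\<omega>. iexp (\<theta> * (C n \<omega> \<bullet> u)) \<partial>M"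
    and "\<epsilon> \<equiv> \<lambda>n. expectation (\<lambda>\<omega>. \<bar>C n \<omega> \<bullet> square_vec u / real (Suc n) - \<tau>\<bar>)
      + expectation (\<lambda>\<omega>. (C n \<omega> \<bullet> u / real (Suc n))\<^sup>2)"
    and "\<kappa>\<^sub>3 \<equiv> (\<bar>\<mu>\<bar> * norm u) ^ 3 / 6 + \<mu>\<^sup>2 * \<tau> / 2 * (\<bar>\<mu>\<bar> * norm u)"
    and "\<kappa>\<^sub>4 \<equiv> (\<mu>\<^sup>2 * \<tau> / 2)\<^sup>2 / 2"
  shows "cmod (f (Suc n) \<theta> - of_real (exp (- (\<mu>\<^sup>2 * \<tau> / 2 * \<theta>\<^sup>2))) * f n (\<theta> * (1 + \<mu> / real (Suc n))))
    \<le> (\<mu>\<^sup>2 / 2 * \<epsilon> n + \<kappa>\<^sub>3 * \<bar>\<theta>\<bar> + \<kappa>\<^sub>4 * \<theta>\<^sup>2) * \<theta>\<^sup>2"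
proof -
  define m where "m = (\<lambda>\<omega>. C n \<omega> \<bullet> u / real (Suc n))"
  define V where "V = (\<lambda>\<omega>. C n \<omega> \<bullet> square_vec u / real (Suc n))"
  define a where "a = \<mu>\<^sup>2 * \<tau> / 2 * \<theta>\<^sup>2"
  define g where "g = (\<lambda>\<omega>. iexp (\<theta> * (C n \<omega> \<bullet> u)))"
  define x where "x = (\<lambda>i. \<theta> * \<mu> * u $ i)"
  define G where "G = (\<lambda>\<omega>. \<Sum>i\<in>UNIV. (C n \<omega> $ i / real (Suc n)) *\<^sub>R iexp (x i))"
  define H where "H = (\<lambda>\<omega>. iexp (\<theta> * \<mu> * m \<omega>) * of_real (exp (- a)))"
  have a: "0 \<le> a" using \<tau> by (simp add: a_def)
  have [measurable]: "m \<in> borel_measurable M" "V \<in> borel_measurable M"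
    unfolding m_def V_def by (intro borel_measurable_divide urn_inner_measurable; simp)+
  have int_m: "integrable M (\<lambda>\<omega>. (m \<omega>)\<^sup>2)" and int_V: "integrable M (\<lambda>\<omega>. \<bar>V \<omega> - \<tau>\<bar>)"
    unfolding m_def V_def using integrable_urn_inner_square integrable_urn_inner
    by (auto simp: power_divide)
  have [measurable]: "G \<in> borel_measurable M"
    unfolding G_def by (intro borel_measurable_sum borel_measurable_scaleR borel_measurable_divide
      urn_component_measurable borel_measurable_const)
  have g_past: "g \<in> borel_measurable (past n)"
    unfolding g_def using urn_inner_past_measurable[of n n u] by measurable
  note [measurable] = past_measurable_lift[OF g_past]
  have H_meas [measurable]: "H \<in> borel_measurable M" unfolding H_def by measurable
  have norm_g: "cmod (g \<omega>) = 1" for \<omega> by (simp add: g_def)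
  have f_Suc: "f (Suc n) \<theta> = (\<integral>\<omega>. g \<omega> * G \<omega> \<partial>M)"
  proof -
    have "f (Suc n) \<theta> = (\<integral>\<omega>. g \<omega> * iexp (x (X (Suc n) \<omega>)) \<partial>M)"
      unfolding f_def
    proof (intro Bochner_Integration.integral_cong refl)
      fix \<omega> assume "\<omega> \<in> space M"
      hence "\<theta> * (C (Suc n) \<omega> \<bullet> u) = \<theta> * (C n \<omega> \<bullet> u) + x (X (Suc n) \<omega>)"
        by (simp add: eigenvector_step[OF eig] x_def algebra_simps)
      thus "iexp (\<theta> * (C (Suc n) \<omega> \<bullet> u)) = g \<omega> * iexp (x (X (Suc n) \<omega>))"
        by (simp add: g_def distrib_left exp_add)
    qed
    also have "\<dots> = (\<integral>\<omega>. g \<omega> * G \<omega> \<partial>M)"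
      unfolding G_def by (rule expectation_draw_algebra[OF g_past, of 1]) (simp add: norm_g)
    finally show ?thesis .
  qed
  have f_n: "of_real (exp (- a)) * f n (\<theta> * (1 + \<mu> / real (Suc n))) = (\<integral>\<omega>. g \<omega> * H \<omega> \<partial>M)"
  proof -
    have "of_real (exp (- a)) * f n (\<theta> * (1 + \<mu> / real (Suc n)))
        = (\<integral>\<omega>. of_real (exp (- a)) * iexp (\<theta> * (1 + \<mu> / real (Suc n)) * (C n \<omega> \<bullet> u)) \<partial>M)"
      unfolding f_def by (rule Bochner_Integration.integral_mult_right_zero[symmetric])
    also have "\<dots> = (\<integral>\<omega>. g \<omega> * H \<omega> \<partial>M)"
    proof (intro Bochner_Integration.integral_cong refl)
      fix \<omega>
      have "\<theta> * (1 + \<mu> / real (Suc n)) * (C n \<omega> \<bullet> u) = \<theta> * (C n \<omega> \<bullet> u) + \<theta> * \<mu> * m \<omega>"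
        by (simp add: m_def algebra_simps)
      thus "of_real (exp (- a)) * iexp (\<theta> * (1 + \<mu> / real (Suc n)) * (C n \<omega> \<bullet> u)) = g \<omega> * H \<omega>"
        by (simp only: g_def H_def of_real_add distrib_left exp_add mult_ac)
    qed
    finally show ?thesis .
  qed
  have bound: "cmod (G \<omega> - H \<omega>)
      \<le> \<mu>\<^sup>2 * \<theta>\<^sup>2 / 2 * (\<bar>V \<omega> - \<tau>\<bar> + (m \<omega>)\<^sup>2) + (\<kappa>\<^sub>3 * \<bar>\<theta>\<bar> + \<kappa>\<^sub>4 * \<theta>\<^sup>2) * \<theta>\<^sup>2"
    if \<omega>: "\<omega> \<in> space M" for \<omega>
  proof -
    define p where "p = (\<lambda>i. C n \<omega> $ i / real (Suc n))"
    have p: "0 \<le> p i" "(\<Sum>i\<in>UNIV. p i) = 1" for i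
      using urn_nonneg[OF \<omega>] urn_total[OF \<omega>, of n]
      by (simp_all add: p_def sum_divide_distrib[symmetric] del: of_nat_Suc)
    have px: "(\<Sum>i\<in>UNIV. p i * x i) = \<theta> * \<mu> * m \<omega>"
      by (simp add: p_def x_def m_def inner_vec_def sum_distrib_left sum_divide_distrib mult_ac)
    have px2: "(\<Sum>i\<in>UNIV. p i * (x i)\<^sup>2) = \<theta>\<^sup>2 * \<mu>\<^sup>2 * V \<omega>"
      by (simp add: p_def x_def V_def inner_vec_def square_vec_def sum_distrib_left sum_divide_distrib
          power_mult_distrib mult_ac)
    have x: "\<bar>x i\<bar> \<le> \<bar>\<theta>\<bar> * (\<bar>\<mu>\<bar> * norm u)" for i
      using component_le_norm_cart[of u i] by (simp add: x_def abs_mult mult_left_mono mult.assoc)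
    have "cmod (G \<omega> - H \<omega>) \<le> \<bar>\<theta>\<^sup>2 * \<mu>\<^sup>2 * V \<omega> - 2 * a\<bar> / 2 + (\<theta> * \<mu> * m \<omega>)\<^sup>2 / 2
        + (\<bar>\<theta>\<bar> * (\<bar>\<mu>\<bar> * norm u)) ^ 3 / 6 + a * (\<bar>\<theta>\<bar> * (\<bar>\<mu>\<bar> * norm u)) + a\<^sup>2 / 2"
      using weighted_iexp_approx[of p x, OF p x a] unfolding px px2 by (simp only: G_def H_def p_def)
    also have "\<theta>\<^sup>2 * \<mu>\<^sup>2 * V \<omega> - 2 * a = (\<theta>\<^sup>2 * \<mu>\<^sup>2) * (V \<omega> - \<tau>)"
      by (simp add: a_def algebra_simps)
    also have "\<bar>(\<theta>\<^sup>2 * \<mu>\<^sup>2) * (V \<omega> - \<tau>)\<bar> / 2 + (\<theta> * \<mu> * m \<omega>)\<^sup>2 / 2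
        + (\<bar>\<theta>\<bar> * (\<bar>\<mu>\<bar> * norm u)) ^ 3 / 6 + a * (\<bar>\<theta>\<bar> * (\<bar>\<mu>\<bar> * norm u)) + a\<^sup>2 / 2
        = \<mu>\<^sup>2 * \<theta>\<^sup>2 / 2 * (\<bar>V \<omega> - \<tau>\<bar> + (m \<omega>)\<^sup>2) + (\<kappa>\<^sub>3 * \<bar>\<theta>\<bar> + \<kappa>\<^sub>4 * \<theta>\<^sup>2) * \<bar>\<theta>\<bar>\<^sup>2"
    proof -
      define T U where "T = \<bar>\<theta>\<bar>" and "U = \<bar>\<mu>\<bar>"
      have TU: "\<theta>\<^sup>2 = T\<^sup>2" "\<mu>\<^sup>2 = U\<^sup>2" by (simp_all add: T_def U_def)
      have "\<bar>(\<theta>\<^sup>2 * \<mu>\<^sup>2) * (V \<omega> - \<tau>)\<bar> = T\<^sup>2 * U\<^sup>2 * \<bar>V \<omega> - \<tau>\<bar>"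
        by (simp add: abs_mult TU)
      moreover have "(\<theta> * \<mu> * m \<omega>)\<^sup>2 = T\<^sup>2 * U\<^sup>2 * (m \<omega>)\<^sup>2"
        by (simp add: power_mult_distrib TU)
      ultimately show ?thesis
        unfolding a_def \<kappa>\<^sub>3_def \<kappa>\<^sub>4_def TU T_def[symmetric] U_def[symmetric]
        by (simp add: field_simps power2_eq_square power3_eq_cube)
    qed
    finally show ?thesis by simp
  qed
  have int_g: "integrable M (\<lambda>\<omega>. g \<omega> * G \<omega>)" "integrable M (\<lambda>\<omega>. g \<omega> * H \<omega>)"
  proof -
    have H1: "cmod (H \<omega>) \<le> 1" for \<omega>
      unfolding H_def norm_mult norm_exp_i_times norm_of_real using a by simp
    show "integrable M (\<lambda>\<omega>. g \<omega> * H \<omega>)"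
      by (rule integrable_bounded[where B = 1]) (use H1 in \<open>auto simp: norm_mult norm_g\<close>)
    have G1: "cmod (G \<omega>) \<le> 1" if \<omega>: "\<omega> \<in> space M" for \<omega>
    proof -
      have "cmod (G \<omega>) \<le> (\<Sum>i\<in>UNIV. C n \<omega> $ i / real (Suc n))"
        unfolding G_def using urn_nonneg[OF \<omega>] by (intro order.trans[OF norm_sum] sum_mono) simp
      also have "\<dots> = 1" using urn_total[OF \<omega>, of n]
        by (simp add: sum_divide_distrib[symmetric] del: of_nat_Suc)
      finally show ?thesis .
    qed
    show "integrable M (\<lambda>\<omega>. g \<omega> * G \<omega>)"
      by (rule integrable_bounded[where B = 1]) (use G1 in \<open>auto simp: norm_mult norm_g\<close>)
  qed
  have "f (Suc n) \<theta> - of_real (exp (- a)) * f n (\<theta> * (1 + \<mu> / real (Suc n)))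
      = (\<integral>\<omega>. g \<omega> * G \<omega> - g \<omega> * H \<omega> \<partial>M)"
    unfolding f_Suc f_n using int_g by simp
  also have "cmod \<dots> \<le> (\<integral>\<omega>. cmod (g \<omega> * G \<omega> - g \<omega> * H \<omega>) \<partial>M)"
    by (rule integral_norm_bound)
  also have "\<dots> \<le> (\<integral>\<omega>. \<mu>\<^sup>2 * \<theta>\<^sup>2 / 2 * (\<bar>V \<omega> - \<tau>\<bar> + (m \<omega>)\<^sup>2) + (\<kappa>\<^sub>3 * \<bar>\<theta>\<bar> + \<kappa>\<^sub>4 * \<theta>\<^sup>2) * \<theta>\<^sup>2 \<partial>M)"
  proof (rule integral_mono)
    show "cmod (g \<omega> * G \<omega> - g \<omega> * H \<omega>)
        \<le> \<mu>\<^sup>2 * \<theta>\<^sup>2 / 2 * (\<bar>V \<omega> - \<tau>\<bar> + (m \<omega>)\<^sup>2) + (\<kappa>\<^sub>3 * \<bar>\<theta>\<bar> + \<kappa>\<^sub>4 * \<theta>\<^sup>2) * \<theta>\<^sup>2"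
      if "\<omega> \<in> space M" for \<omega>
      using bound[OF that] by (simp add: right_diff_distrib[symmetric] norm_mult norm_g)
  qed (use int_g int_m int_V in auto)
  also have "\<dots> = (\<mu>\<^sup>2 / 2 * \<epsilon> n + \<kappa>\<^sub>3 * \<bar>\<theta>\<bar> + \<kappa>\<^sub>4 * \<theta>\<^sup>2) * \<theta>\<^sup>2"
    using int_m int_V by (simp add: \<epsilon>_def m_def V_def prob_space algebra_simps)
  finally show ?thesis unfolding a_def .
qed


text \<open>The recursion is unrolled from \<open>t / A\<^sub>N\<close>. The squares of the arguments met are
\<open>t\<^sup>2 / (D\<^sub>N \<Pi>\<^sub>k\<^sup>2)\<close>, so both the exponent of the Gaussian factor and the error coming from \<open>\<epsilon>\<close> are
averages with weights \<open>1 / \<Pi>\<^sub>k\<^sup>2\<close> divided by \<open>D\<^sub>N\<close>, and Stolz-Cesaro applies to each. The cubic and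
quartic errors carry an additional factor \<open>max \<bar>\<theta>\<bar>\<close>, which tends to zero.\<close>

lemma char_recursion_limit:
  fixes f :: "nat \<Rightarrow> real \<Rightarrow> complex" and A \<epsilon> :: "nat \<Rightarrow> real"
  assumes b: "b > -1" and c: "c \<ge> 0"
    and step: "\<And>n \<theta>. cmod (f (Suc n) \<theta> - of_real (exp (- (c * \<theta>\<^sup>2))) * f n (\<theta> * (1 + b / real (Suc n))))
      \<le> (K * \<epsilon> n + \<kappa>\<^sub>3 * \<bar>\<theta>\<bar> + \<kappa>\<^sub>4 * \<theta>\<^sup>2) * \<theta>\<^sup>2"
    and \<kappa>: "0 \<le> \<kappa>\<^sub>3" "0 \<le> \<kappa>\<^sub>4"
    and \<epsilon>: "\<epsilon> \<longlonglongrightarrow> 0"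
    and start: "(f 0 \<longlongrightarrow> 1) (at 0)" "f 0 0 = 1"
    and A: "filterlim A at_top sequentially"
    and D: "D = (\<lambda>n. (A n / Pi_norm n b)\<^sup>2)"
    and D_inc: "eventually (\<lambda>n. D n < D (Suc n)) sequentially"
    and D_lim: "filterlim D at_top sequentially"
    and ratio: "(\<lambda>n. 1 / (Pi_norm (Suc n) b)\<^sup>2 / (D (Suc n) - D n)) \<longlonglongrightarrow> L"
  shows "(\<lambda>N. f N (t / A N)) \<longlonglongrightarrow> of_real (exp (- (c * t\<^sup>2 * L)))"
proof -
  define P where "P = (\<lambda>n. Pi_norm n b)"
  have P: "P n > 0" for n unfolding P_def by (rule Pi_norm_pos[OF b])
  define r where "r = (\<lambda>N. t * (P N / A N))"
  \<comment> \<open>The weights of the Gaussian exponents, plain and multiplied with the errors \<open>\<epsilon>\<close>.\<close>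
  define x where "x = (\<lambda>N. \<Sum>k<N. 1 / (P (Suc k))\<^sup>2)"
  define y where "y = (\<lambda>N. \<Sum>k<N. \<epsilon> k / (P (Suc k))\<^sup>2)"
  define \<eta> where "\<eta> = (\<lambda>N. \<bar>t\<bar> * (max 1 (P N) / \<bar>A N\<bar>))"
  have x: "(\<lambda>N. x N / D N) \<longlonglongrightarrow> L"
    using stolz_cesaro[OF D_inc D_lim, of x L] ratio by (simp add: x_def P_def)
  have y: "(\<lambda>N. y N / D N) \<longlonglongrightarrow> 0"
  proof (rule stolz_cesaro[OF D_inc D_lim])
    have "(\<lambda>n. \<epsilon> n * (1 / (Pi_norm (Suc n) b)\<^sup>2 / (D (Suc n) - D n))) \<longlonglongrightarrow> 0 * L"
      by (rule tendsto_mult[OF \<epsilon> ratio])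
    thus "(\<lambda>n. (y (Suc n) - y n) / (D (Suc n) - D n)) \<longlonglongrightarrow> 0"
      by (simp add: y_def P_def)
  qed
  have PA: "(\<lambda>N. \<bar>P N / A N\<bar>) \<longlonglongrightarrow> 0"
  proof -
    have "(\<lambda>N. sqrt (inverse (D N))) \<longlonglongrightarrow> sqrt 0"
      by (intro tendsto_real_sqrt tendsto_inverse_0_at_top[OF D_lim])
    thus ?thesis by (simp add: D P_def power_divide real_sqrt_divide divide_simps flip: power_inverse)
  qed
  have invA: "(\<lambda>N. \<bar>1 / A N\<bar>) \<longlonglongrightarrow> 0"
    using tendsto_inverse_0_at_top[OF A] by (intro tendsto_rabs_zero) (simp add: inverse_eq_divide)
  have \<eta>: "\<eta> \<longlonglongrightarrow> 0"
  proof -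
    have "(\<lambda>N. \<bar>t\<bar> * max \<bar>1 / A N\<bar> \<bar>P N / A N\<bar>) \<longlonglongrightarrow> \<bar>t\<bar> * max 0 0"
      by (intro tendsto_intros PA invA)
    moreover have "max \<bar>1 / A N\<bar> \<bar>P N / A N\<bar> = max 1 (P N) / \<bar>A N\<bar>" for N
      using P[of N] by (auto simp: max_def divide_le_cancel)
    ultimately show ?thesis by (simp add: \<eta>_def)
  qed
  have r: "r \<longlonglongrightarrow> 0"
    using tendsto_mult_right_zero[OF tendsto_rabs_zero_cancel[OF PA], of t] by (simp add: r_def)
  have "isCont (f 0) 0" using start by (simp add: isCont_def)
  hence f0: "(\<lambda>N. f 0 (r N)) \<longlonglongrightarrow> 1" using isCont_tendsto_compose[OF _ r] start(2) by metis
  \<comment> \<open>The arguments met when the recursion is unrolled from \<open>t / A N\<close>.\<close>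
  define W where "W = (\<lambda>N k. r N / P (Suc k))"
  have W2: "(W N k)\<^sup>2 = t\<^sup>2 / D N * (1 / (P (Suc k))\<^sup>2)" for N k
    by (simp add: W_def r_def D P_def power_divide power_mult_distrib)
  have W_sum: "(\<Sum>k<N. (W N k)\<^sup>2) = t\<^sup>2 * (x N / D N)" for N
    unfolding W2 x_def by (simp add: sum_distrib_left sum_divide_distrib mult_ac)
  have W_bound: "\<bar>W N k\<bar> \<le> \<eta> N" if "k < N" for N k
  proof -
    have "\<bar>W N k\<bar> = \<bar>t\<bar> * ((P N / P (Suc k)) / \<bar>A N\<bar>)"
      using P by (simp add: W_def r_def abs_mult abs_of_pos)
    also have "\<dots> \<le> \<eta> N"
      unfolding \<eta>_def P_def using Pi_norm_ratio_le[OF b, of "Suc k" N] that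
      by (intro mult_left_mono divide_right_mono) auto
    finally show ?thesis .
  qed
  have close: "cmod (f N (t / A N) - of_real (exp (- (c * (t\<^sup>2 * (x N / D N))))) * f 0 (r N))
      \<le> K * t\<^sup>2 * (y N / D N) + (\<kappa>\<^sub>3 * \<eta> N + \<kappa>\<^sub>4 * (\<eta> N)\<^sup>2) * (t\<^sup>2 * (x N / D N))" for N
  proof -
    have "cmod (f N (r N / P N) - of_real (exp (- (c * (\<Sum>k<N. (W N k)\<^sup>2)))) * f 0 (r N))
        \<le> (\<Sum>k<N. (K * \<epsilon> k + \<kappa>\<^sub>3 * \<bar>W N k\<bar> + \<kappa>\<^sub>4 * (W N k)\<^sup>2) * (W N k)\<^sup>2)"
      unfolding W_def P_def by (rule char_recursion_telescope[OF b c step])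
    also have "\<dots> \<le> (\<Sum>k<N. (K * \<epsilon> k + (\<kappa>\<^sub>3 * \<eta> N + \<kappa>\<^sub>4 * (\<eta> N)\<^sup>2)) * (W N k)\<^sup>2)"
    proof (intro sum_mono mult_right_mono)
      fix k assume "k \<in> {..<N}"
      hence w: "\<bar>W N k\<bar> \<le> \<eta> N" using W_bound by simp
      have "(W N k)\<^sup>2 \<le> (\<eta> N)\<^sup>2" using power_mono[OF w, of 2] by simp
      thus "K * \<epsilon> k + \<kappa>\<^sub>3 * \<bar>W N k\<bar> + \<kappa>\<^sub>4 * (W N k)\<^sup>2 \<le> K * \<epsilon> k + (\<kappa>\<^sub>3 * \<eta> N + \<kappa>\<^sub>4 * (\<eta> N)\<^sup>2)"
        using w \<kappa> by (simp add: add_mono mult_left_mono)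
    qed auto
    also have "\<dots> = K * (\<Sum>k<N. \<epsilon> k * (W N k)\<^sup>2) + (\<kappa>\<^sub>3 * \<eta> N + \<kappa>\<^sub>4 * (\<eta> N)\<^sup>2) * (\<Sum>k<N. (W N k)\<^sup>2)"
      by (simp add: algebra_simps sum.distrib sum_distrib_left)
    also have "(\<Sum>k<N. \<epsilon> k * (W N k)\<^sup>2) = t\<^sup>2 * (y N / D N)"
      unfolding W2 y_def by (simp add: sum_distrib_left sum_divide_distrib mult_ac)
    finally have *: "cmod (f N (r N / P N) - of_real (exp (- (c * (t\<^sup>2 * (x N / D N))))) * f 0 (r N))
      \<le> K * t\<^sup>2 * (y N / D N) + (\<kappa>\<^sub>3 * \<eta> N + \<kappa>\<^sub>4 * (\<eta> N)\<^sup>2) * (t\<^sup>2 * (x N / D N))"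
      unfolding W_sum by (simp only: mult.assoc)
    have "r N / P N = t / A N" using P[of N] by (simp add: r_def)
    with * show ?thesis by simp
  qed
  have "(\<lambda>N. K * t\<^sup>2 * (y N / D N) + (\<kappa>\<^sub>3 * \<eta> N + \<kappa>\<^sub>4 * (\<eta> N)\<^sup>2) * (t\<^sup>2 * (x N / D N)))
      \<longlonglongrightarrow> K * t\<^sup>2 * 0 + (\<kappa>\<^sub>3 * 0 + \<kappa>\<^sub>4 * 0\<^sup>2) * (t\<^sup>2 * L)"
    by (intro tendsto_intros x y \<eta>)
  hence "(\<lambda>N. f N (t / A N) - of_real (exp (- (c * (t\<^sup>2 * (x N / D N))))) * f 0 (r N)) \<longlonglongrightarrow> 0"
    by (intro Lim_null_comparison[OF always_eventually[OF allI[OF close]]]) simp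
  moreover have "(\<lambda>N. of_real (exp (- (c * (t\<^sup>2 * (x N / D N))))) * f 0 (r N))
      \<longlonglongrightarrow> of_real (exp (- (c * (t\<^sup>2 * L)))) * 1"
    by (intro tendsto_intros x f0)
  ultimately have "(\<lambda>N. (f N (t / A N) - of_real (exp (- (c * (t\<^sup>2 * (x N / D N))))) * f 0 (r N))
      + of_real (exp (- (c * (t\<^sup>2 * (x N / D N))))) * f 0 (r N)) \<longlonglongrightarrow> 0 + of_real (exp (- (c * (t\<^sup>2 * L)))) * 1"
    by (rule tendsto_add)
  thus ?thesis by (simp add: mult.assoc)
qed

text \<open>The norming \<open>A\<close> is left open so that the diffusive and the critical regime are both instances;
they differ only in the value of \<open>L\<close>.\<close>

lemma (in urn_process) eigenvector_central_limit:
  fixes A :: "nat \<Rightarrow> real"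
  assumes eig: "R *v u = \<mu> *\<^sub>R u" and \<mu>: "\<bar>\<mu>\<bar> < 1" and \<tau>: "0 \<le> \<tau>"
    and lln: "(\<lambda>n. expectation (\<lambda>\<omega>. \<bar>C n \<omega> \<bullet> square_vec u / real (Suc n) - \<tau>\<bar>)) \<longlonglongrightarrow> 0"
    and A: "filterlim A at_top sequentially"
    and D: "D = (\<lambda>n. (A n / Pi_norm n \<mu>)\<^sup>2)"
    and D_inc: "eventually (\<lambda>n. D n < D (Suc n)) sequentially"
    and D_lim: "filterlim D at_top sequentially"
    and ratio: "(\<lambda>n. 1 / (Pi_norm (Suc n) \<mu>)\<^sup>2 / (D (Suc n) - D n)) \<longlonglongrightarrow> L"
    and L: "0 \<le> L"
  shows "converges_in_distribution M (\<lambda>n \<omega>. (C n \<omega> \<bullet> u) / A n) (normal_law 0 (\<mu>\<^sup>2 * L * \<tau>))"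
proof -
  define f where "f = (\<lambda>n \<theta>. \<integral>\<omega>. iexp (\<theta> * (C n \<omega> \<bullet> u)) \<partial>M)"
  have meas: "(\<lambda>\<omega>. (C n \<omega> \<bullet> u) / A n) \<in> borel_measurable M" for n by measurable
  have f0: "f 0 \<theta> = iexp (\<theta> * (c0 \<bullet> u))" for \<theta>
  proof -
    have "f 0 \<theta> = (\<integral>\<omega>. iexp (\<theta> * (c0 \<bullet> u)) \<partial>M)"
      unfolding f_def by (intro Bochner_Integration.integral_cong refl) (simp add: initial)
    thus ?thesis by (simp add: prob_space)
  qed
  have "(f 0 \<longlongrightarrow> iexp (0 * (c0 \<bullet> u))) (at 0)"
    unfolding f0 by (intro tendsto_intros)
  hence start: "(f 0 \<longlongrightarrow> 1) (at 0)" "f 0 0 = 1" by (simp_all add: f0)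
  define \<epsilon> where "\<epsilon> = (\<lambda>n. expectation (\<lambda>\<omega>. \<bar>C n \<omega> \<bullet> square_vec u / real (Suc n) - \<tau>\<bar>)
      + expectation (\<lambda>\<omega>. (C n \<omega> \<bullet> u / real (Suc n))\<^sup>2))"
  have \<epsilon>: "\<epsilon> \<longlonglongrightarrow> 0"
    using tendsto_add[OF lln second_moment_negligible[OF eig]] \<mu> by (simp add: \<epsilon>_def)
  define \<kappa>\<^sub>3 where "\<kappa>\<^sub>3 = (\<bar>\<mu>\<bar> * norm u) ^ 3 / 6 + \<mu>\<^sup>2 * \<tau> / 2 * (\<bar>\<mu>\<bar> * norm u)"
  define \<kappa>\<^sub>4 where "\<kappa>\<^sub>4 = (\<mu>\<^sup>2 * \<tau> / 2)\<^sup>2 / 2"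
  have \<kappa>: "0 \<le> \<kappa>\<^sub>3" "0 \<le> \<kappa>\<^sub>4" using \<tau> by (simp_all add: \<kappa>\<^sub>3_def \<kappa>\<^sub>4_def)
  have step: "cmod (f (Suc n) \<theta> - of_real (exp (- (\<mu>\<^sup>2 * \<tau> / 2 * \<theta>\<^sup>2))) * f n (\<theta> * (1 + \<mu> / real (Suc n))))
      \<le> (\<mu>\<^sup>2 / 2 * \<epsilon> n + \<kappa>\<^sub>3 * \<bar>\<theta>\<bar> + \<kappa>\<^sub>4 * \<theta>\<^sup>2) * \<theta>\<^sup>2" for n \<theta>
    unfolding f_def \<epsilon>_def \<kappa>\<^sub>3_def \<kappa>\<^sub>4_def by (rule char_step[OF eig \<tau>])
  have lim: "(\<lambda>N. f N (t / A N)) \<longlonglongrightarrow> of_real (exp (- (\<mu>\<^sup>2 * \<tau> / 2 * t\<^sup>2 * L)))" for t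
    using \<mu> \<tau>
    by (intro char_recursion_limit[OF _ _ step \<kappa> \<epsilon> start A D D_inc D_lim ratio]) auto
  have "weak_conv_m (\<lambda>n. distr M borel (\<lambda>\<omega>. (C n \<omega> \<bullet> u) / A n)) (normal_law 0 (\<mu>\<^sup>2 * L * \<tau>))"
  proof (rule levy_continuity)
    show "real_distribution (distr M borel (\<lambda>\<omega>. (C n \<omega> \<bullet> u) / A n))" for n
      using meas by (rule real_distribution_distr)
    show "real_distribution (normal_law 0 (\<mu>\<^sup>2 * L * \<tau>))"
      using L \<tau> by (intro real_distribution_normal_law) simp
    fix t
    have "char (distr M borel (\<lambda>\<omega>. (C n \<omega> \<bullet> u) / A n)) t = f n (t / A n)" for n
      unfolding char_def f_def by (subst integral_distr[OF meas]) auto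
    moreover have "char (normal_law 0 (\<mu>\<^sup>2 * L * \<tau>)) t = of_real (exp (- (\<mu>\<^sup>2 * \<tau> / 2 * t\<^sup>2 * L)))"
      using L \<tau> by (subst char_normal_law) (auto simp: mult_ac)
    ultimately show "(\<lambda>n. char (distr M borel (\<lambda>\<omega>. (C n \<omega> \<bullet> u) / A n)) t)
        \<longlonglongrightarrow> char (normal_law 0 (\<mu>\<^sup>2 * L * \<tau>)) t"
      using lim[of t] by simp
  qed
  thus ?thesis unfolding converges_in_distribution_def using meas by simp
qed

section \<open>Square-integrable martingales\<close>

context prob_space
begin

lemma integrable_mult_of_squares:
  fixes f g :: "'a \<Rightarrow> real"
  assumes [measurable]: "f \<in> borel_measurable M" "g \<in> borel_measurable M"
    and "integrable M (\<lambda>\<omega>. (f \<omega>)\<^sup>2)" "integrable M (\<lambda>\<omega>. (g \<omega>)\<^sup>2)"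
  shows "integrable M (\<lambda>\<omega>. f \<omega> * g \<omega>)"
proof (rule Bochner_Integration.integrable_bound)
  show "integrable M (\<lambda>\<omega>. (f \<omega>)\<^sup>2 + (g \<omega>)\<^sup>2)" using assms by simp
  have "\<bar>a * b\<bar> \<le> a\<^sup>2 + b\<^sup>2" for a b :: real
  proof -
    have "0 \<le> (\<bar>a\<bar> - \<bar>b\<bar>)\<^sup>2" "0 \<le> \<bar>a\<bar> * \<bar>b\<bar>" by simp_all
    thus ?thesis unfolding power2_diff abs_mult power2_abs by linarith
  qed
  thus "AE \<omega> in M. norm (f \<omega> * g \<omega>) \<le> norm ((f \<omega>)\<^sup>2 + (g \<omega>)\<^sup>2)" by simp
qed measurable

context
  fixes F :: "nat \<Rightarrow> 'a measure" and Z :: "nat \<Rightarrow> 'a \<Rightarrow> real"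
  assumes mart: "martingale M F Z"
    and square: "\<And>n. integrable M (\<lambda>\<omega>. (Z n \<omega>)\<^sup>2)"
begin

lemma martingale_subalgebra: "subalgebra M (F n)"
  and martingale_adapted: "Z n \<in> borel_measurable (F n)"
  and martingale_filtration: "m \<le> n \<Longrightarrow> sets (F m) \<subseteq> sets (F n)"
  using mart by (auto simp: martingale_def filtration_def)

lemma martingale_adapted_later: "m \<le> n \<Longrightarrow> Z m \<in> borel_measurable (F n)"
  using martingale_adapted[of m] martingale_filtration[of m n]
    martingale_subalgebra[of m] martingale_subalgebra[of n]
  by (auto simp: measurable_def subalgebra_def)

lemma martingale_measurable [measurable]: "Z n \<in> borel_measurable M"
  by (rule measurable_from_subalg[OF martingale_subalgebra martingale_adapted])

text \<open>Multipliers \<open>g\<close> that are only square-integrable are admitted because the martingale itself, cut off by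
events of the past, serves as multiplier below.\<close>

lemma martingale_orthogonal:
  assumes mn: "m \<le> n" and g: "g \<in> borel_measurable (F m)" "integrable M (\<lambda>\<omega>. (g \<omega>)\<^sup>2)"
  shows "expectation (\<lambda>\<omega>. g \<omega> * Z n \<omega>) = expectation (\<lambda>\<omega>. g \<omega> * Z m \<omega>)"
proof -
  interpret past: sigma_finite_subalgebra M "F m"
    by (intro finite_measure_subalgebra_is_sigma_finite)
      (simp add: finite_measure_subalgebra_def finite_measure_subalgebra_axioms_def
        martingale_subalgebra finite_measure_axioms)
  have gM [measurable]: "g \<in> borel_measurable M"
    by (rule measurable_from_subalg[OF martingale_subalgebra g(1)])
  have "expectation (\<lambda>\<omega>. g \<omega> * Z n \<omega>) = expectation (\<lambda>\<omega>. g \<omega> * real_cond_exp M (F m) (Z n) \<omega>)"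
    by (intro past.real_cond_exp_intg(2)[symmetric] integrable_mult_of_squares g square) measurable
  also have "\<dots> = expectation (\<lambda>\<omega>. g \<omega> * Z m \<omega>)"
  proof (rule integral_cong_AE)
    have "AE \<omega> in M. real_cond_exp M (F m) (Z n) \<omega> = Z m \<omega>"
      using mart mn by (simp add: martingale_def)
    thus "AE \<omega> in M. g \<omega> * real_cond_exp M (F m) (Z n) \<omega> = g \<omega> * Z m \<omega>" by eventually_elim simp
  qed measurable
  finally show ?thesis .
qed

lemma martingale_increment_square:
  assumes mn: "m \<le> n"
  shows "expectation (\<lambda>\<omega>. (Z n \<omega> - Z m \<omega>)\<^sup>2)
    = expectation (\<lambda>\<omega>. (Z n \<omega>)\<^sup>2) - expectation (\<lambda>\<omega>. (Z m \<omega>)\<^sup>2)"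
proof -
  have "expectation (\<lambda>\<omega>. (Z n \<omega> - Z m \<omega>)\<^sup>2)
      = expectation (\<lambda>\<omega>. (Z n \<omega>)\<^sup>2 + (Z m \<omega>)\<^sup>2 - 2 * (Z m \<omega> * Z n \<omega>))"
    by (simp add: power2_diff mult_ac)
  also have "\<dots> = expectation (\<lambda>\<omega>. (Z n \<omega>)\<^sup>2) + expectation (\<lambda>\<omega>. (Z m \<omega>)\<^sup>2)
      - 2 * expectation (\<lambda>\<omega>. Z m \<omega> * Z n \<omega>)"
    using square integrable_mult_of_squares[OF martingale_measurable martingale_measurable square square, of m n] 
    by simp
  also have "expectation (\<lambda>\<omega>. Z m \<omega> * Z n \<omega>) = expectation (\<lambda>\<omega>. (Z m \<omega>)\<^sup>2)"
    using martingale_orthogonal[OF mn martingale_adapted square] by (simp add: power2_eq_square)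
  finally show ?thesis by simp
qed

lemma martingale_second_moment_mono:
  assumes "m \<le> n"
  shows "expectation (\<lambda>\<omega>. (Z m \<omega>)\<^sup>2) \<le> expectation (\<lambda>\<omega>. (Z n \<omega>)\<^sup>2)"
proof -
  have "0 \<le> expectation (\<lambda>\<omega>. (Z n \<omega> - Z m \<omega>)\<^sup>2)" by simp
  thus ?thesis using martingale_increment_square[OF assms] by simp
qed

lemma integrable_difference_square: "integrable M (\<lambda>\<omega>. (Z n \<omega> - Z m \<omega>)\<^sup>2)"
proof -
  have "integrable M (\<lambda>\<omega>. (Z n \<omega>)\<^sup>2 + (Z m \<omega>)\<^sup>2 - 2 * (Z n \<omega> * Z m \<omega>))"
    using square integrable_mult_of_squares[OF martingale_measurable martingale_measurable square square, of n m]
    by simp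
  thus ?thesis by (simp add: power2_diff mult_ac)
qed

text \<open>Doob's argument: split the event according to the first time \<open>k\<close> at which the threshold is exceeded.
On that part, which belongs to the past at time \<open>n + k\<close>, the later increment is orthogonal to the
value at time \<open>k\<close>, so waiting until the terminal time can only increase the second moment.\<close>

lemma martingale_maximal_inequality:
  assumes \<epsilon>: "\<epsilon> > 0"
  shows "prob {\<omega> \<in> space M. \<exists>k\<le>m. \<epsilon> \<le> \<bar>Z (n + k) \<omega> - Z n \<omega>\<bar>}
    \<le> (expectation (\<lambda>\<omega>. (Z (n + m) \<omega>)\<^sup>2) - expectation (\<lambda>\<omega>. (Z n \<omega>)\<^sup>2)) / \<epsilon>\<^sup>2"
proof -
  define D where "D = (\<lambda>k \<omega>. Z (n + k) \<omega> - Z n \<omega>)"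
  define A where "A = (\<lambda>k. {\<omega> \<in> space M. \<epsilon> \<le> \<bar>D k \<omega>\<bar> \<and> (\<forall>j<k. \<bar>D j \<omega>\<bar> < \<epsilon>)})"
  have D_past: "D j \<in> borel_measurable (F (n + k))" if "j \<le> k" for j k
    unfolding D_def using that martingale_adapted_later[of "n + j" "n + k"] martingale_adapted_later[of n "n + k"]
    by auto
  have [measurable]: "D j \<in> borel_measurable M" for j unfolding D_def by measurable
  have D_sq: "integrable M (\<lambda>\<omega>. (D k \<omega>)\<^sup>2)" for k
    unfolding D_def by (rule integrable_difference_square)
  have A_past: "A k \<in> sets (F (n + k))" for k
  proof -
    have sp: "space M = space (F (n + k))" using martingale_subalgebra by (simp add: subalgebra_def)
    have "{\<omega> \<in> space (F (n + k)). \<epsilon> \<le> \<bar>D k \<omega>\<bar> \<and> (\<forall>j\<in>{..<k}. \<bar>D j \<omega>\<bar> < \<epsilon>)} \<in> sets (F (n + k))"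
      by (intro sets.sets_Collect sets.sets_Collect_finite_All borel_measurable_le borel_measurable_less
          borel_measurable_abs D_past) auto
    thus ?thesis by (simp add: A_def sp lessThan_def)
  qed
  hence A [measurable]: "A k \<in> sets M" for k
    using martingale_subalgebra[of "n + k"] by (auto simp: subalgebra_def)
  have first: "\<epsilon>\<^sup>2 * prob (A k) \<le> expectation (\<lambda>\<omega>. indicator (A k) \<omega> * (D m \<omega>)\<^sup>2)" if k: "k \<le> m" for k
  proof -
    define g where "g = (\<lambda>\<omega>. indicator (A k) \<omega> * D k \<omega>)"
    have [measurable]: "g \<in> borel_measurable M" unfolding g_def by measurable
    have g_past: "g \<in> borel_measurable (F (n + k))"
      unfolding g_def using A_past D_past[of k k] by (intro borel_measurable_times borel_measurable_indicator) auto
    have g_sq: "integrable M (\<lambda>\<omega>. (g \<omega>)\<^sup>2)"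
    proof (rule Bochner_Integration.integrable_bound[OF D_sq[of k]])
      show "AE \<omega> in M. norm ((g \<omega>)\<^sup>2) \<le> norm ((D k \<omega>)\<^sup>2)" by (simp add: g_def indicator_def)
    qed measurable
    have int: "integrable M (\<lambda>\<omega>. g \<omega> * D m \<omega>)" "integrable M (\<lambda>\<omega>. g \<omega> * D k \<omega>)"
      by (auto intro!: integrable_mult_of_squares g_sq D_sq)
    have gZ: "integrable M (\<lambda>\<omega>. g \<omega> * Z j \<omega>)" for j
      by (intro integrable_mult_of_squares g_sq square) measurable
    \<comment> \<open>Orthogonality of the increment after the first passage to the past.\<close>
    have cross: "expectation (\<lambda>\<omega>. g \<omega> * D m \<omega>) = expectation (\<lambda>\<omega>. g \<omega> * D k \<omega>)"
      using martingale_orthogonal[OF _ g_past g_sq, of "n + m"] k gZ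
      by (simp add: D_def right_diff_distrib)
    have int_A: "integrable M (\<lambda>\<omega>. indicator (A k) \<omega> * (D j \<omega>)\<^sup>2)" for j
      using integrable_mult_indicator[OF A[of k] D_sq[of j]] by simp
    have int_A': "integrable M (\<lambda>\<omega>. indicator (A k) \<omega> * (D m \<omega> - D k \<omega>)\<^sup>2)"
      using integrable_mult_indicator[OF A[of k] integrable_difference_square[of "n + m" "n + k"]]
      by (simp add: D_def)
    have "\<epsilon>\<^sup>2 * prob (A k) = expectation (\<lambda>\<omega>. \<epsilon>\<^sup>2 * indicator (A k) \<omega>)"
      by simp
    also have "\<dots> \<le> expectation (\<lambda>\<omega>. indicator (A k) \<omega> * (D k \<omega>)\<^sup>2)"
    proof (rule integral_mono)
      fix \<omega>
      have "\<epsilon>\<^sup>2 \<le> (D k \<omega>)\<^sup>2" if "\<omega> \<in> A k"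
        using that \<epsilon> power_mono[of \<epsilon> "\<bar>D k \<omega>\<bar>" 2] by (simp add: A_def)
      thus "\<epsilon>\<^sup>2 * indicator (A k) \<omega> \<le> indicator (A k) \<omega> * (D k \<omega>)\<^sup>2" by (simp add: indicator_def)
    qed (use int_A integrable_real_indicator[OF A[of k]] in \<open>auto simp: emeasure_eq_measure\<close>)
    also have "\<dots> \<le> expectation (\<lambda>\<omega>. indicator (A k) \<omega> * (D k \<omega>)\<^sup>2)
        + expectation (\<lambda>\<omega>. indicator (A k) \<omega> * (D m \<omega> - D k \<omega>)\<^sup>2)"
      by (simp add: integral_nonneg_AE)
    also have "\<dots> = expectation (\<lambda>\<omega>. indicator (A k) \<omega> * (D k \<omega>)\<^sup>2)
        + 2 * (expectation (\<lambda>\<omega>. g \<omega> * D m \<omega>) - expectation (\<lambda>\<omega>. g \<omega> * D k \<omega>))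
        + expectation (\<lambda>\<omega>. indicator (A k) \<omega> * (D m \<omega> - D k \<omega>)\<^sup>2)"
      using cross by simp
    also have "\<dots> = expectation (\<lambda>\<omega>. indicator (A k) \<omega> * (D k \<omega>)\<^sup>2
        + 2 * (g \<omega> * D m \<omega> - g \<omega> * D k \<omega>) + indicator (A k) \<omega> * (D m \<omega> - D k \<omega>)\<^sup>2)"
      using int int_A int_A' by simp
    also have "\<dots> = expectation (\<lambda>\<omega>. indicator (A k) \<omega> * (D m \<omega>)\<^sup>2)"
      by (intro Bochner_Integration.integral_cong refl)
        (simp add: g_def power2_eq_square algebra_simps)
    finally show ?thesis .
  qed
  have "{\<omega> \<in> space M. \<exists>k\<le>m. \<epsilon> \<le> \<bar>D k \<omega>\<bar>} = (\<Union>k\<in>{..m}. A k)"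
  proof (intro equalityI subsetI)
    fix \<omega> assume "\<omega> \<in> {\<omega> \<in> space M. \<exists>k\<le>m. \<epsilon> \<le> \<bar>D k \<omega>\<bar>}"
    then obtain k where \<omega>: "\<omega> \<in> space M" and k: "k \<le> m" "\<epsilon> \<le> \<bar>D k \<omega>\<bar>" by blast
    define l where "l = (LEAST k. \<epsilon> \<le> \<bar>D k \<omega>\<bar>)"
    have "\<epsilon> \<le> \<bar>D l \<omega>\<bar>" "l \<le> k" unfolding l_def using k by (auto intro: LeastI Least_le)
    moreover have "\<bar>D j \<omega>\<bar> < \<epsilon>" if "j < l" for j using not_less_Least[OF that[unfolded l_def]] by simp
    ultimately show "\<omega> \<in> (\<Union>k\<in>{..m}. A k)" using \<omega> k by (auto simp: A_def)
  qed (auto simp: A_def)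
  moreover have "prob (\<Union>k\<in>{..m}. A k) \<le> (\<Sum>k\<le>m. prob (A k))"
    by (rule finite_measure_subadditive_finite) auto
  ultimately have "\<epsilon>\<^sup>2 * prob {\<omega> \<in> space M. \<exists>k\<le>m. \<epsilon> \<le> \<bar>D k \<omega>\<bar>} \<le> (\<Sum>k\<le>m. \<epsilon>\<^sup>2 * prob (A k))"
    by (simp add: sum_distrib_left[symmetric] mult_left_mono)
  also have "\<dots> \<le> (\<Sum>k\<le>m. expectation (\<lambda>\<omega>. indicator (A k) \<omega> * (D m \<omega>)\<^sup>2))"
    using first by (intro sum_mono) simp
  also have "\<dots> = expectation (\<lambda>\<omega>. \<Sum>k\<le>m. indicator (A k) \<omega> * (D m \<omega>)\<^sup>2)"
    using integrable_mult_indicator[OF A D_sq[of m]]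
    by (subst Bochner_Integration.integral_sum) auto
  also have "\<dots> \<le> expectation (\<lambda>\<omega>. (D m \<omega>)\<^sup>2)"
  proof (rule integral_mono)
    fix \<omega>
    have disjoint: "\<omega> \<notin> A i" if "i < l" "\<omega> \<in> A l" for i l
    proof -
      have "\<bar>D i \<omega>\<bar> < \<epsilon>" using that unfolding A_def by blast
      thus ?thesis by (simp add: A_def)
    qed
    have "(\<Sum>k\<le>m. indicator (A k) \<omega> :: real) \<le> 1"
    proof (cases "\<exists>k\<le>m. \<omega> \<in> A k")
      case True
      then obtain k where k: "k \<le> m" "\<omega> \<in> A k" by blast
      have "indicator (A j) \<omega> = (if j = k then 1 else 0 :: real)" for j
      proof (cases "j = k")
        case False
        hence "\<omega> \<notin> A j" using disjoint[of j k] disjoint[of k j] k(2) by (meson nat_neq_iff)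
        thus ?thesis using False by simp
      qed (use k in simp)
      thus ?thesis by simp
    qed (simp add: indicator_def)
    thus "(\<Sum>k\<le>m. indicator (A k) \<omega> * (D m \<omega>)\<^sup>2) \<le> (D m \<omega>)\<^sup>2"
      by (simp add: sum_distrib_right[symmetric] mult_left_le_one_le sum_nonneg)
    show "integrable M (\<lambda>\<omega>. \<Sum>k\<le>m. indicator (A k) \<omega> * (D m \<omega>)\<^sup>2)"
      using integrable_mult_indicator[OF A D_sq[of m]] by (intro Bochner_Integration.integrable_sum) simp
  qed (rule D_sq)
  also have "\<dots> = expectation (\<lambda>\<omega>. (Z (n + m) \<omega>)\<^sup>2) - expectation (\<lambda>\<omega>. (Z n \<omega>)\<^sup>2)"
    unfolding D_def by (rule martingale_increment_square) simp
  finally show ?thesis using \<epsilon> by (simp add: D_def field_simps)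
qed


context
  fixes B :: real
  assumes bounded: "\<And>n. expectation (\<lambda>\<omega>. (Z n \<omega>)\<^sup>2) \<le> B"
begin

lemma martingale_second_moment_converges:
  obtains v where "(\<lambda>n. expectation (\<lambda>\<omega>. (Z n \<omega>)\<^sup>2)) \<longlonglongrightarrow> v"
    "\<And>n. expectation (\<lambda>\<omega>. (Z n \<omega>)\<^sup>2) \<le> v"
proof (rule incseq_convergent)
  show "incseq (\<lambda>n. expectation (\<lambda>\<omega>. (Z n \<omega>)\<^sup>2))"
    using martingale_second_moment_mono by (simp add: incseq_def)
qed (use bounded that in auto)

text \<open>The second moments increase to a finite limit, so by the maximal inequality the oscillation after
time \<open>n\<close> exceeds a given threshold with a probability that tends to zero. Hence almost every path
is a Cauchy sequence.\<close>

lemma martingale_L2_converges_AE: "AE \<omega> in M. convergent (\<lambda>n. Z n \<omega>)"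
proof -
  obtain v where v: "(\<lambda>n. expectation (\<lambda>\<omega>. (Z n \<omega>)\<^sup>2)) \<longlonglongrightarrow> v"
    and v_upper: "\<And>n. expectation (\<lambda>\<omega>. (Z n \<omega>)\<^sup>2) \<le> v"
    using martingale_second_moment_converges by blast
  define E where "E = (\<lambda>\<epsilon> n. {\<omega> \<in> space M. \<exists>k. \<epsilon> \<le> \<bar>Z (n + k) \<omega> - Z n \<omega>\<bar>})"
  have E [measurable]: "E \<epsilon> n \<in> sets M" for \<epsilon> n unfolding E_def by measurable
  have small: "prob (E \<epsilon> n) \<le> (v - expectation (\<lambda>\<omega>. (Z n \<omega>)\<^sup>2)) / \<epsilon>\<^sup>2" if \<epsilon>: "\<epsilon> > 0" for \<epsilon> n
  proof -
    define G where "G = (\<lambda>m. {\<omega> \<in> space M. \<exists>k\<le>m. \<epsilon> \<le> \<bar>Z (n + k) \<omega> - Z n \<omega>\<bar>})"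
    have "range G \<subseteq> sets M" unfolding G_def by auto
    moreover have "incseq G" unfolding G_def incseq_def by (auto intro: order.trans)
    ultimately have "(\<lambda>m. prob (G m)) \<longlonglongrightarrow> prob (\<Union>m. G m)" by (rule finite_Lim_measure_incseq)
    moreover have "(\<Union>m. G m) = E \<epsilon> n" by (auto simp: G_def E_def)
    moreover have "prob (G m) \<le> (v - expectation (\<lambda>\<omega>. (Z n \<omega>)\<^sup>2)) / \<epsilon>\<^sup>2" for m
      unfolding G_def using v_upper[of "n + m"]
      by (intro order.trans[OF martingale_maximal_inequality[OF \<epsilon>]] divide_right_mono) auto
    ultimately show ?thesis by (auto intro: LIMSEQ_le_const2)
  qed
  have null: "AE \<omega> in M. \<exists>n. \<omega> \<notin> E \<epsilon> n" if \<epsilon>: "\<epsilon> > 0" for \<epsilon>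
  proof -
    have "(\<lambda>n. (v - expectation (\<lambda>\<omega>. (Z n \<omega>)\<^sup>2)) / \<epsilon>\<^sup>2) \<longlonglongrightarrow> (v - v) / \<epsilon>\<^sup>2"
      using \<epsilon> by (intro tendsto_intros v) auto
    moreover have "prob (\<Inter>n. E \<epsilon> n) \<le> (v - expectation (\<lambda>\<omega>. (Z n \<omega>)\<^sup>2)) / \<epsilon>\<^sup>2" for n
    proof -
      have "prob (\<Inter>n. E \<epsilon> n) \<le> prob (E \<epsilon> n)" by (intro finite_measure_mono) auto
      thus ?thesis using small[OF \<epsilon>, of n] by linarith
    qed
    ultimately have "prob (\<Inter>n. E \<epsilon> n) \<le> (v - v) / \<epsilon>\<^sup>2" by (intro LIMSEQ_le_const) auto
    hence "prob (\<Inter>n. E \<epsilon> n) = 0" by (simp add: measure_le_0_iff)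
    hence "(\<Inter>n. E \<epsilon> n) \<in> null_sets M" by (intro null_setsI) (auto simp: emeasure_eq_measure)
    hence "AE \<omega> in M. \<omega> \<notin> (\<Inter>n. E \<epsilon> n)" by (rule AE_not_in)
    thus ?thesis by eventually_elim auto
  qed
  have "AE \<omega> in M. \<forall>j. \<exists>n. \<omega> \<notin> E (1 / real (Suc j)) n"
    unfolding AE_all_countable using null by simp
  thus ?thesis
  proof (rule AE_mp, intro AE_I2 impI)
    fix \<omega> assume \<omega>: "\<omega> \<in> space M" and near: "\<forall>j. \<exists>n. \<omega> \<notin> E (1 / real (Suc j)) n"
    have "Cauchy (\<lambda>n. Z n \<omega>)"
    proof (rule metric_CauchyI)
      fix e :: real assume "e > 0"
      then obtain j where j: "1 / real (Suc j) < e / 2"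
        using nat_approx_posE[of "e / 2"] by auto
      obtain n where n: "\<omega> \<notin> E (1 / real (Suc j)) n" using near by blast
      have *: "\<bar>Z p \<omega> - Z n \<omega>\<bar> < e / 2" if "n \<le> p" for p
      proof -
        have "\<bar>Z (n + (p - n)) \<omega> - Z n \<omega>\<bar> < 1 / real (Suc j)"
          using n \<omega> unfolding E_def by (auto simp: not_le)
        thus ?thesis using j that by simp
      qed
      have "dist (Z p \<omega>) (Z q \<omega>) < e" if "n \<le> p" "n \<le> q" for p q
        using *[OF that(1)] *[OF that(2)] unfolding dist_real_def by linarith
      thus "\<exists>N. \<forall>p\<ge>N. \<forall>q\<ge>N. dist (Z p \<omega>) (Z q \<omega>) < e" by blast
    qed
    thus "convergent (\<lambda>n. Z n \<omega>)" by (simp add: Cauchy_convergent_iff)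
  qed
qed

text \<open>Fatou's lemma bounds the mean square distance of \<open>Z\<^sub>n\<close> to the limit \<open>c\<close> by \<open>v - E Z\<^sub>n\<^sup>2\<close>, where \<open>v\<close> is the
limit of the second moments, so this distance tends to zero. But the distance to a constant is
\<open>E Z\<^sub>n\<^sup>2\<close> up to a term independent of \<open>n\<close>, hence nondecreasing and therefore identically zero.\<close>

lemma martingale_limit_constant_imp_second_moment_constant:
  assumes lim: "AE \<omega> in M. (\<lambda>n. Z n \<omega>) \<longlonglongrightarrow> c"
  shows "expectation (\<lambda>\<omega>. (Z n \<omega>)\<^sup>2) = expectation (\<lambda>\<omega>. (Z 0 \<omega>)\<^sup>2)"
proof -
  obtain v where v: "(\<lambda>n. expectation (\<lambda>\<omega>. (Z n \<omega>)\<^sup>2)) \<longlonglongrightarrow> v"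
    and v_upper: "\<And>n. expectation (\<lambda>\<omega>. (Z n \<omega>)\<^sup>2) \<le> v"
    using martingale_second_moment_converges by blast
  have int_Z: "integrable M (Z n)" for n using mart by (simp add: martingale_def)
  have int_c: "integrable M (\<lambda>\<omega>. (c - Z n \<omega>)\<^sup>2)" for n
    using int_Z[of n] square[of n] by (simp add: power2_diff)
  have mean: "expectation (Z n) = expectation (Z 0)" for n
    using martingale_orthogonal[of 0 n "\<lambda>_. 1"] by simp
  have expand: "expectation (\<lambda>\<omega>. (c - Z n \<omega>)\<^sup>2)
      = c\<^sup>2 - 2 * c * expectation (Z 0) + expectation (\<lambda>\<omega>. (Z n \<omega>)\<^sup>2)" for n
    using int_Z[of n] square[of n] by (simp add: power2_diff prob_space mean[of n])
  have fatou: "expectation (\<lambda>\<omega>. (c - Z n \<omega>)\<^sup>2) \<le> v - expectation (\<lambda>\<omega>. (Z n \<omega>)\<^sup>2)" for n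
  proof -
    have "ennreal (expectation (\<lambda>\<omega>. (c - Z n \<omega>)\<^sup>2)) = (\<integral>\<^sup>+\<omega>. ennreal ((c - Z n \<omega>)\<^sup>2) \<partial>M)"
      using int_c by (intro nn_integral_eq_integral[symmetric]) auto
    also have "\<dots> = (\<integral>\<^sup>+\<omega>. liminf (\<lambda>k. ennreal ((Z k \<omega> - Z n \<omega>)\<^sup>2)) \<partial>M)"
    proof (rule nn_integral_cong_AE)
      show "AE \<omega> in M. ennreal ((c - Z n \<omega>)\<^sup>2) = liminf (\<lambda>k. ennreal ((Z k \<omega> - Z n \<omega>)\<^sup>2))"
        using lim
      proof eventually_elim
        case (elim \<omega>)
        have "(\<lambda>k. ennreal ((Z k \<omega> - Z n \<omega>)\<^sup>2)) \<longlonglongrightarrow> ennreal ((c - Z n \<omega>)\<^sup>2)"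
          by (intro tendsto_intros tendsto_ennrealI elim)
        thus ?case by (intro lim_imp_Liminf[symmetric]) auto
      qed
    qed
    also have "\<dots> \<le> liminf (\<lambda>k. \<integral>\<^sup>+\<omega>. ennreal ((Z k \<omega> - Z n \<omega>)\<^sup>2) \<partial>M)"
      by (rule nn_integral_liminf) measurable
    also have "\<dots> \<le> ennreal (v - expectation (\<lambda>\<omega>. (Z n \<omega>)\<^sup>2))"
    proof (rule Liminf_le)
      show "\<forall>\<^sub>F k in sequentially. (\<integral>\<^sup>+\<omega>. ennreal ((Z k \<omega> - Z n \<omega>)\<^sup>2) \<partial>M)
          \<le> ennreal (v - expectation (\<lambda>\<omega>. (Z n \<omega>)\<^sup>2))"
        using eventually_ge_at_top[of n]
      proof eventually_elim
        case (elim k)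
        have "(\<integral>\<^sup>+\<omega>. ennreal ((Z k \<omega> - Z n \<omega>)\<^sup>2) \<partial>M) = ennreal (expectation (\<lambda>\<omega>. (Z k \<omega> - Z n \<omega>)\<^sup>2))"
          using integrable_difference_square by (intro nn_integral_eq_integral) auto
        thus ?case using martingale_increment_square[OF elim] v_upper[of k] by (simp add: ennreal_leI)
      qed
    qed simp
    finally show ?thesis using v_upper[of n] by simp
  qed
  have "(\<lambda>n. c\<^sup>2 - 2 * c * expectation (Z 0) + expectation (\<lambda>\<omega>. (Z n \<omega>)\<^sup>2))
      \<longlonglongrightarrow> c\<^sup>2 - 2 * c * expectation (Z 0) + v" by (intro tendsto_intros v)
  moreover have "(\<lambda>n. v - expectation (\<lambda>\<omega>. (Z n \<omega>)\<^sup>2)) \<longlonglongrightarrow> v - v" by (intro tendsto_intros v)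
  ultimately have upper: "c\<^sup>2 - 2 * c * expectation (Z 0) + v \<le> v - v"
    using fatou unfolding expand by (intro LIMSEQ_le) auto
  have "expectation (\<lambda>\<omega>. (Z n \<omega>)\<^sup>2) = v" for n
  proof -
    have "0 \<le> expectation (\<lambda>\<omega>. (c - Z n \<omega>)\<^sup>2)" by simp
    thus ?thesis using upper v_upper[of n] unfolding expand by linarith
  qed
  thus ?thesis by simp
qed

end

end

end

section \<open>Normalised eigenvector projections\<close>

context urn_process
begin

lemma eigenvector_martingale:
  assumes eig: "R *v u = \<mu> *\<^sub>R u" and \<mu>: "\<mu> > -1"
  shows "martingale M (natural_filtration M C) (\<lambda>n \<omega>. (C n \<omega> \<bullet> u) / Pi_norm n \<mu>)"
proof -
  define Z where "Z = (\<lambda>n \<omega>. (C n \<omega> \<bullet> u) / Pi_norm n \<mu>)"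
  have int: "integrable M (Z n)" for n
    unfolding Z_def by (intro integrable_divide integrable_urn_inner)
  have past: "Z n \<in> borel_measurable (past n)" for n
    unfolding Z_def using urn_inner_past_measurable[of n n u] by measurable
  have step: "expectation (\<lambda>\<omega>. indicator A \<omega> * Z (Suc n) \<omega>) = expectation (\<lambda>\<omega>. indicator A \<omega> * Z n \<omega>)"
    if A: "A \<in> sets (past n)" for A n
  proof -
    have A_M [measurable]: "A \<in> sets M" using A past_subalgebra by (auto simp: subalgebra_def)
    have int_S: "integrable M (\<lambda>\<omega>. indicator A \<omega> * (C n \<omega> \<bullet> u))"
      using integrable_mult_indicator[OF A_M integrable_urn_inner] by simp
    have int_u: "integrable M (\<lambda>\<omega>. indicator A \<omega> * u $ X (Suc n) \<omega>)"
    proof (rule integrable_bounded[where B = "1 * norm u"])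
      show "norm (indicator A \<omega> * u $ X (Suc n) \<omega>) \<le> 1 * norm u" for \<omega>
        unfolding norm_mult using component_le_norm_cart[of u] by (intro mult_mono) (auto simp: indicator_def)
    qed (use draw_component_measurable[of "\<lambda>i. u $ i"] in measurable)
    have center: "expectation (\<lambda>\<omega>. indicator A \<omega> * u $ X (Suc n) \<omega>)
        = expectation (\<lambda>\<omega>. indicator A \<omega> * (C n \<omega> \<bullet> u)) / real (Suc n)"
      using A by (intro expectation_draw[of _ _ 1]) (auto simp: indicator_def)
    have "expectation (\<lambda>\<omega>. indicator A \<omega> * Z (Suc n) \<omega>)
        = expectation (\<lambda>\<omega>. (indicator A \<omega> * (C n \<omega> \<bullet> u) + \<mu> * (indicator A \<omega> * u $ X (Suc n) \<omega>)) / Pi_norm (Suc n) \<mu>)"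
      by (intro Bochner_Integration.integral_cong refl)
        (simp add: Z_def eigenvector_step[OF eig] algebra_simps)
    also have "\<dots> = (expectation (\<lambda>\<omega>. indicator A \<omega> * (C n \<omega> \<bullet> u))
        + \<mu> * expectation (\<lambda>\<omega>. indicator A \<omega> * u $ X (Suc n) \<omega>)) / Pi_norm (Suc n) \<mu>"
      using int_S int_u by simp
    also have "\<dots> = expectation (\<lambda>\<omega>. indicator A \<omega> * (C n \<omega> \<bullet> u)) * (1 + \<mu> / (real n + 1)) / Pi_norm (Suc n) \<mu>"
      unfolding center by (simp add: algebra_simps)
    also have "\<dots> = expectation (\<lambda>\<omega>. indicator A \<omega> * (C n \<omega> \<bullet> u)) / Pi_norm n \<mu>"
      using Pi_norm_factor_pos[OF \<mu>, of n] by (simp add: Pi_norm_Suc del: of_nat_Suc)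
    also have "\<dots> = expectation (\<lambda>\<omega>. indicator A \<omega> * Z n \<omega>)" by (simp add: Z_def)
    finally show ?thesis .
  qed
  have cond: "AE \<omega> in M. real_cond_exp M (past m) (Z n) \<omega> = Z m \<omega>" if mn: "m \<le> n" for m n
  proof -
    interpret past: sigma_finite_subalgebra M "past m" by (rule past_sigma_finite)
    show ?thesis
    proof (rule past.real_cond_exp_charact)
      fix A assume A: "A \<in> sets (past m)"
      have "expectation (\<lambda>\<omega>. indicator A \<omega> * Z n \<omega>) = expectation (\<lambda>\<omega>. indicator A \<omega> * Z m \<omega>)"
        using mn
      proof (induction n rule: dec_induct)
        case (step k)
        thus ?case using \<open>\<And>A n. A \<in> sets (past n) \<Longrightarrow> _ = _\<close>[of A k] A past_mono[of m k] by auto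
      qed simp
      thus "set_lebesgue_integral M A (Z n) = set_lebesgue_integral M A (Z m)"
        by (simp add: set_lebesgue_integral_def)
    qed (use int past in auto)
  qed
  show ?thesis
    unfolding martingale_def Z_def[symmetric]
    using past_subalgebra past int cond past_mono by (auto simp: filtration_def)
qed

text \<open>For \<open>\<mu> > 1/2\<close> the growth bound is available with the critical exponent \<open>p = 2 \<mu>\<close> itself, which is also
the order of \<open>\<Pi>\<^sub>n\<^sup>2\<close>.\<close>

lemma eigenvector_L2_bounded:
  assumes eig: "R *v u = \<mu> *\<^sub>R u" and \<mu>: "1 / 2 < \<mu>"
  shows "L2_bounded M (\<lambda>n \<omega>. (C n \<omega> \<bullet> u) / Pi_norm n \<mu>)"
proof -
  obtain A where A: "\<And>n. expectation (\<lambda>\<omega>. (C n \<omega> \<bullet> u)\<^sup>2) \<le> A * real (Suc n) powr (2 * \<mu>)"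
    using second_moment_growth[OF eig, of "2 * \<mu>"] \<mu> by auto
  obtain c where c: "c > 0" "(\<lambda>n. Pi_norm n \<mu> / real n powr \<mu>) \<longlonglongrightarrow> c"
    using Pi_norm_asymptotics[of \<mu>] \<mu> by auto
  have "(\<lambda>n. real (Suc n) powr \<mu> / real n powr \<mu>) \<longlonglongrightarrow> 1" by real_asymp
  hence "(\<lambda>n. (real (Suc n) powr \<mu> / real n powr \<mu>) / (Pi_norm n \<mu> / real n powr \<mu>)) \<longlonglongrightarrow> 1 / c"
    using c by (intro tendsto_divide) auto
  moreover have "\<forall>\<^sub>F n in sequentially. (real (Suc n) powr \<mu> / real n powr \<mu>) / (Pi_norm n \<mu> / real n powr \<mu>)
      = real (Suc n) powr \<mu> / Pi_norm n \<mu>"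
    using eventually_gt_at_top[of 0] by eventually_elim simp
  ultimately have "(\<lambda>n. real (Suc n) powr \<mu> / Pi_norm n \<mu>) \<longlonglongrightarrow> 1 / c"
    by (rule Lim_transform_eventually)
  hence "Bseq (\<lambda>n. real (Suc n) powr \<mu> / Pi_norm n \<mu>)" by (intro convergent_imp_Bseq) (auto simp: convergent_def)
  then obtain K where K: "K > 0" "\<And>n. \<bar>real (Suc n) powr \<mu> / Pi_norm n \<mu>\<bar> \<le> K"
    by (auto simp: Bseq_def)
  have "expectation (\<lambda>\<omega>. (C n \<omega> \<bullet> u / Pi_norm n \<mu>)\<^sup>2) \<le> \<bar>A\<bar> * K\<^sup>2" for n
  proof -
    have "expectation (\<lambda>\<omega>. (C n \<omega> \<bullet> u / Pi_norm n \<mu>)\<^sup>2) = expectation (\<lambda>\<omega>. (C n \<omega> \<bullet> u)\<^sup>2) / (Pi_norm n \<mu>)\<^sup>2"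
      by (simp add: power_divide)
    also have "\<dots> \<le> A * real (Suc n) powr (2 * \<mu>) / (Pi_norm n \<mu>)\<^sup>2"
      using A by (intro divide_right_mono) auto
    also have "real (Suc n) powr (2 * \<mu>) = (real (Suc n) powr \<mu>)\<^sup>2"
      by (simp add: power2_eq_square powr_add[symmetric])
    also have "A * (real (Suc n) powr \<mu>)\<^sup>2 / (Pi_norm n \<mu>)\<^sup>2 \<le> \<bar>A\<bar> * \<bar>real (Suc n) powr \<mu> / Pi_norm n \<mu>\<bar>\<^sup>2"
      by (simp add: power_divide divide_right_mono mult_right_mono)
    also have "\<dots> \<le> \<bar>A\<bar> * K\<^sup>2" using K(2)[of n] by (intro mult_left_mono power_mono) auto
    finally show ?thesis .
  qed
  thus ?thesis unfolding L2_bounded_def using integrable_urn_inner_square by (auto simp: power_divide)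
qed

lemma eigenvector_almost_sure_limit:
  assumes eig: "R *v u = \<mu> *\<^sub>R u" and \<mu>: "1 / 2 < \<mu>" "\<mu> < 1" and \<tau>: "0 < \<tau>"
    and lln: "(\<lambda>n. expectation (\<lambda>\<omega>. \<bar>C n \<omega> \<bullet> square_vec u / real (Suc n) - \<tau>\<bar>)) \<longlonglongrightarrow> 0"
  shows "\<exists>Y. nondegenerate M Y \<and> (AE \<omega> in M. (\<lambda>n. (C n \<omega> \<bullet> u) / real n powr \<mu>) \<longlonglongrightarrow> Y \<omega>)"
proof -
  define Z where "Z = (\<lambda>n \<omega>. (C n \<omega> \<bullet> u) / Pi_norm n \<mu>)"
  have mart: "martingale M (natural_filtration M C) Z"
    unfolding Z_def using \<mu> by (intro eigenvector_martingale[OF eig]) simp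
  obtain B where square: "\<And>n. integrable M (\<lambda>\<omega>. (Z n \<omega>)\<^sup>2)"
    and B: "\<And>n. expectation (\<lambda>\<omega>. (Z n \<omega>)\<^sup>2) \<le> B"
    using eigenvector_L2_bounded[OF eig \<mu>(1)] unfolding L2_bounded_def Z_def by blast
  obtain c where c: "c > 0" "(\<lambda>n. Pi_norm n \<mu> / real n powr \<mu>) \<longlonglongrightarrow> c"
    using Pi_norm_asymptotics[of \<mu>] \<mu> by auto
  define Y where "Y = (\<lambda>\<omega>. c * lim (\<lambda>n. Z n \<omega>))"
  have [measurable]: "Z n \<in> borel_measurable M" for n unfolding Z_def by measurable
  have Y_meas: "Y \<in> borel_measurable M" unfolding Y_def by measurable
  have conv: "AE \<omega> in M. (\<lambda>n. Z n \<omega>) \<longlonglongrightarrow> lim (\<lambda>n. Z n \<omega>)"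
    using martingale_L2_converges_AE[OF mart square B] by (simp add: convergent_LIMSEQ_iff)
  hence "AE \<omega> in M. (\<lambda>n. (C n \<omega> \<bullet> u) / real n powr \<mu>) \<longlonglongrightarrow> Y \<omega>"
  proof eventually_elim
    case (elim \<omega>)
    have "(\<lambda>n. Pi_norm n \<mu> / real n powr \<mu> * Z n \<omega>) \<longlonglongrightarrow> Y \<omega>"
      unfolding Y_def by (intro tendsto_mult c elim)
    moreover have "Pi_norm n \<mu> / real n powr \<mu> * Z n \<omega> = (C n \<omega> \<bullet> u) / real n powr \<mu>" for n
      using Pi_norm_pos[of \<mu> n] \<mu> by (simp add: Z_def)
    ultimately show ?case by (simp only:)
  qed
  moreover have "\<not> (\<exists>k. AE \<omega> in M. Y \<omega> = k)"
  proof
    assume "\<exists>k. AE \<omega> in M. Y \<omega> = k"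
    then obtain k where "AE \<omega> in M. Y \<omega> = k" by blast
    with conv have "AE \<omega> in M. (\<lambda>n. Z n \<omega>) \<longlonglongrightarrow> k / c"
    proof eventually_elim
      case (elim \<omega>)
      hence "lim (\<lambda>n. Z n \<omega>) = k / c" using c by (simp add: Y_def field_simps)
      with elim show ?case by simp
    qed
    from martingale_limit_constant_imp_second_moment_constant[OF mart square B this]
    have const: "expectation (\<lambda>\<omega>. (Z (Suc n) \<omega>)\<^sup>2) = expectation (\<lambda>\<omega>. (Z n \<omega>)\<^sup>2)" for n by metis
    define x where "x = (\<lambda>n. expectation (\<lambda>\<omega>. (C n \<omega> \<bullet> u)\<^sup>2))"
    define V where "V = (\<lambda>n. expectation (\<lambda>\<omega>. C n \<omega> \<bullet> square_vec u / real (Suc n)))"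
    \<comment> \<open>Equality of consecutive second moments says that the conditional variances have mean zero.\<close>
    have balance: "V n = expectation (\<lambda>\<omega>. (C n \<omega> \<bullet> u / real (Suc n))\<^sup>2)" for n
    proof -
      define q where "q = \<mu> / (real n + 1)"
      have Ppos: "Pi_norm n \<mu> > 0" using \<mu> Pi_norm_pos[of \<mu> n] by simp
      have "x (Suc n) / (Pi_norm (Suc n) \<mu>)\<^sup>2 = x n / (Pi_norm n \<mu>)\<^sup>2"
        using const[of n] by (simp add: Z_def x_def power_divide)
      hence "x (Suc n) = x n / (Pi_norm n \<mu>)\<^sup>2 * (Pi_norm (Suc n) \<mu>)\<^sup>2"
        using \<mu> Pi_norm_pos[of \<mu> "Suc n"] by (simp add: divide_eq_eq)
      also have "\<dots> = x n * (1 + q)\<^sup>2"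
        using Ppos by (simp add: Pi_norm_Suc q_def[symmetric] power_mult_distrib)
      finally have "x (Suc n) = x n * (1 + q)\<^sup>2" .
      moreover have "x (Suc n) = (1 + 2 * q) * x n + \<mu>\<^sup>2 * V n"
        using second_moment_step[OF eig, of n] by (simp add: x_def V_def q_def add.commute)
      ultimately have "\<mu>\<^sup>2 * V n = q\<^sup>2 * x n" by (simp add: power2_eq_square algebra_simps)
      also have "\<dots> = \<mu>\<^sup>2 * (x n / (real (Suc n))\<^sup>2)" by (simp add: q_def power_divide add.commute)
      finally have "\<mu>\<^sup>2 * V n = \<mu>\<^sup>2 * (x n / (real (Suc n))\<^sup>2)" .
      moreover have "\<mu>\<^sup>2 \<noteq> 0" using \<mu> by simp
      ultimately have "V n = x n / (real (Suc n))\<^sup>2" using mult_left_cancel by blast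
      thus ?thesis by (simp add: x_def power_divide del: of_nat_Suc)
    qed
    have "V \<longlonglongrightarrow> 0" unfolding balance by (rule second_moment_negligible[OF eig \<mu>(2)])
    moreover have "V \<longlonglongrightarrow> \<tau>"
    proof (rule LIM_zero_cancel, rule Lim_null_comparison[OF always_eventually lln], rule allI)
      fix n
      have "V n - \<tau> = expectation (\<lambda>\<omega>. C n \<omega> \<bullet> square_vec u / real (Suc n) - \<tau>)"
        using integrable_urn_inner[of n "square_vec u"] by (simp add: V_def prob_space del: of_nat_Suc)
      thus "norm (V n - \<tau>) \<le> expectation (\<lambda>\<omega>. \<bar>C n \<omega> \<bullet> square_vec u / real (Suc n) - \<tau>\<bar>)"
        by (simp add: integral_abs_bound del: of_nat_Suc)
    qed
    ultimately show False using \<tau> LIMSEQ_unique by blast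
  qed
  ultimately show ?thesis unfolding nondegenerate_def using Y_meas by blast
qed

end

text \<open>With \<open>D\<^sub>n = (A\<^sub>n / \<Pi>\<^sub>n)\<^sup>2\<close>, the increment \<open>D\<^sub>n\<^sub>+\<^sub>1 - D\<^sub>n\<close> has the common denominator \<open>\<Pi>\<^sub>n\<^sub>+\<^sub>1\<^sup>2\<close>, so the
product drops out of the ratio and an explicit limit in \<open>A\<close> remains.\<close>

lemma norming_increments:
  fixes A :: "nat \<Rightarrow> real"
  assumes b: "b > -1" and \<delta>: "\<delta> > 0"
    and lim: "(\<lambda>n. (A (Suc n))\<^sup>2 - (A n)\<^sup>2 * (1 + b / (real n + 1))\<^sup>2) \<longlonglongrightarrow> \<delta>"
  defines "D \<equiv> \<lambda>n. (A n / Pi_norm n b)\<^sup>2"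
  shows "eventually (\<lambda>n. D n < D (Suc n)) sequentially"
    and "(\<lambda>n. 1 / (Pi_norm (Suc n) b)\<^sup>2 / (D (Suc n) - D n)) \<longlonglongrightarrow> 1 / \<delta>"
proof -
  define g where "g = (\<lambda>n. (A (Suc n))\<^sup>2 - (A n)\<^sup>2 * (1 + b / (real n + 1))\<^sup>2)"
  have P: "Pi_norm n b > 0" for n by (rule Pi_norm_pos[OF b])
  have incr: "D (Suc n) - D n = g n / (Pi_norm (Suc n) b)\<^sup>2" for n
  proof -
    have "1 + b / (real n + 1) \<noteq> 0" using Pi_norm_factor_pos[OF b, of n] by simp
    hence "D n = (A n)\<^sup>2 * (1 + b / (real n + 1))\<^sup>2 / (Pi_norm (Suc n) b)\<^sup>2"
      using P[of n] by (simp add: D_def Pi_norm_Suc power_divide power_mult_distrib)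
    thus ?thesis by (simp add: D_def g_def power_divide diff_divide_distrib)
  qed
  have "eventually (\<lambda>n. g n > 0) sequentially"
    using lim \<delta> unfolding g_def by (rule order_tendstoD(1))
  thus "eventually (\<lambda>n. D n < D (Suc n)) sequentially"
  proof eventually_elim
    case (elim n)
    hence "g n / (Pi_norm (Suc n) b)\<^sup>2 > 0" using P[of "Suc n"] by simp
    thus ?case using incr[of n] by simp
  qed
  have "(\<lambda>n. 1 / g n) \<longlonglongrightarrow> 1 / \<delta>" using lim \<delta> unfolding g_def by (intro tendsto_divide) auto
  moreover have "1 / (Pi_norm (Suc n) b)\<^sup>2 / (D (Suc n) - D n) = 1 / g n" for n
    using P[of "Suc n"] by (simp add: incr)
  ultimately show "(\<lambda>n. 1 / (Pi_norm (Suc n) b)\<^sup>2 / (D (Suc n) - D n)) \<longlonglongrightarrow> 1 / \<delta>" by simp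
qed

lemma norming_at_top:
  fixes A :: "nat \<Rightarrow> real"
  assumes b: "b > -1" and lim: "filterlim (\<lambda>n. (A n / real n powr b)\<^sup>2) at_top sequentially"
  shows "filterlim (\<lambda>n. (A n / Pi_norm n b)\<^sup>2) at_top sequentially"
proof -
  obtain c where c: "c > 0" "(\<lambda>n. Pi_norm n b / real n powr b) \<longlonglongrightarrow> c"
    using Pi_norm_asymptotics[OF b] by blast
  have inv: "(\<lambda>n. (1 / (Pi_norm n b / real n powr b))\<^sup>2) \<longlonglongrightarrow> (1 / c)\<^sup>2"
    using c by (intro tendsto_intros) auto
  hence "filterlim (\<lambda>n. (1 / (Pi_norm n b / real n powr b))\<^sup>2 * (A n / real n powr b)\<^sup>2) at_top sequentially"
    using c by (intro filterlim_tendsto_pos_mult_at_top[OF inv _ lim]) simp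
  moreover have "\<forall>\<^sub>F n in sequentially. (1 / (Pi_norm n b / real n powr b))\<^sup>2 * (A n / real n powr b)\<^sup>2
      = (A n / Pi_norm n b)\<^sup>2"
    using eventually_gt_at_top[of 0] by eventually_elim (simp add: power_divide power_mult_distrib)
  ultimately show ?thesis by (rule filterlim_cong[THEN iffD1, OF refl refl, rotated])
qed

context urn_process
begin

lemma eigenvector_diffusive_limit:
  assumes eig: "R *v u = \<mu> *\<^sub>R u" and \<mu>: "-1 < \<mu>" "\<mu> < 1 / 2" and \<tau>: "0 \<le> \<tau>"
    and lln: "(\<lambda>n. expectation (\<lambda>\<omega>. \<bar>C n \<omega> \<bullet> square_vec u / real (Suc n) - \<tau>\<bar>)) \<longlonglongrightarrow> 0"
  shows "converges_in_distribution M (\<lambda>n \<omega>. (C n \<omega> \<bullet> u) / sqrt (real n))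
    (normal_law 0 (\<mu>\<^sup>2 / (1 - 2 * \<mu>) * \<tau>))"
proof -
  have "(\<lambda>n. (sqrt (real (Suc n)))\<^sup>2 - (sqrt (real n))\<^sup>2 * (1 + \<mu> / (real n + 1))\<^sup>2) \<longlonglongrightarrow> 1 - 2 * \<mu>"
  proof -
    have "(\<lambda>n. real n + 1 - real n * (1 + \<mu> / (real n + 1))\<^sup>2) \<longlonglongrightarrow> 1 - 2 * \<mu>" by real_asymp
    thus ?thesis by (simp add: add.commute)
  qed
  note incr = norming_increments[OF \<mu>(1) _ this]
  have "filterlim (\<lambda>n. (sqrt (real n) / real n powr \<mu>)\<^sup>2) at_top sequentially"
    using \<mu> by real_asymp
  note D_lim = norming_at_top[OF \<mu>(1) this]
  have "filterlim (\<lambda>n. sqrt (real n)) at_top sequentially" by real_asymp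
  from eigenvector_central_limit[OF eig _ \<tau> lln this refl incr(1) D_lim incr(2)] \<mu>
  show ?thesis by simp
qed

lemma eigenvector_critical_limit:
  assumes eig: "R *v u = (1 / 2) *\<^sub>R u" and \<tau>: "0 \<le> \<tau>"
    and lln: "(\<lambda>n. expectation (\<lambda>\<omega>. \<bar>C n \<omega> \<bullet> square_vec u / real (Suc n) - \<tau>\<bar>)) \<longlonglongrightarrow> 0"
  shows "converges_in_distribution M (\<lambda>n \<omega>. (C n \<omega> \<bullet> u) / sqrt (real n * ln (real n)))
    (normal_law 0 ((1 / 2)\<^sup>2 * \<tau>))"
proof -
  define A where "A = (\<lambda>n. sqrt (real n * ln (real n)))"
  have A2: "(A n)\<^sup>2 = real n * ln (real n)" for n
    unfolding A_def by (cases n) auto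
  have "(\<lambda>n. (real n + 1) * ln (real n + 1) - real n * ln (real n) * (1 + 1 / 2 / (real n + 1))\<^sup>2) \<longlonglongrightarrow> 1"
    by real_asymp
  hence "(\<lambda>n. (A (Suc n))\<^sup>2 - (A n)\<^sup>2 * (1 + 1 / 2 / (real n + 1))\<^sup>2) \<longlonglongrightarrow> 1"
    unfolding A2 by (simp add: add.commute)
  note incr = norming_increments[of "1/2", OF _ _ this]
  have "filterlim (\<lambda>n. (A n / real n powr (1/2))\<^sup>2) at_top sequentially"
    unfolding power_divide A2 by real_asymp
  note D_lim = norming_at_top[of "1/2", OF _ this]
  have "filterlim A at_top sequentially" unfolding A_def by real_asymp
  from eigenvector_central_limit[OF eig _ \<tau> lln this refl incr(1) D_lim incr(2)]
  show ?thesis by (simp add: A_def)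
qed

end

section \<open>Block triangular replacement matrices\<close>

definition upper_embedding :: "real ^ 'm \<Rightarrow> real ^ ('m::finite + 'n::finite)" where
  "upper_embedding x = (\<chi> i. case i of Inl a \<Rightarrow> x $ a | Inr b \<Rightarrow> 0)"

lemma upper_embedding_nth [simp]:
  "upper_embedding x $ Inl a = x $ a" "upper_embedding x $ Inr b = 0"
  by (simp_all add: upper_embedding_def)

lemma sum_block_index:
  fixes f :: "'m::finite + 'n::finite \<Rightarrow> real"
  shows "(\<Sum>i\<in>UNIV. f i) = (\<Sum>a\<in>UNIV. f (Inl a)) + (\<Sum>b\<in>UNIV. f (Inr b))"
  by (subst UNIV_Plus_UNIV[symmetric], subst sum.Plus) auto

lemma block_triangular_mult:
  "(block_matrix A E 0 P *v v) $ Inl a = (A *v (\<chi> i. v $ Inl i)) $ a + (E *v lower_half v) $ a"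
  "(block_matrix A E 0 P *v v) $ Inr b = (P *v lower_half v) $ b"
  by (simp_all add: matrix_vector_mult_def sum_block_index block_matrix_def lower_half_def)

lemma block_triangular_upper_eigenvector:
  assumes "A *v x = \<mu> *\<^sub>R x"
  shows "block_matrix A E 0 P *v upper_embedding x = \<mu> *\<^sub>R upper_embedding x"
proof -
  have low: "lower_half (upper_embedding x) = 0" by (simp add: lower_half_def vec_eq_iff)
  have up: "(\<chi> i. upper_embedding x $ Inl i) = x" by (simp add: vec_eq_iff)
  show ?thesis
    unfolding vec_eq_iff
  proof
    fix i show "(block_matrix A E 0 P *v upper_embedding x) $ i = (\<mu> *\<^sub>R upper_embedding x) $ i"
      by (cases i) (simp_all add: block_triangular_mult up low assms)
  qed
qed

lemma stochastic_mult_vec: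
  assumes "stochastic_matrix A" shows "A *v vec c = vec c"
  using assms
  by (simp add: vec_eq_iff matrix_vector_mult_def stochastic_matrix_def prob_vector_def row_def
      sum_distrib_right[symmetric])

lemma vec_2_combination:
  fixes x y :: "real ^ 2"
  assumes "y $ 1 \<noteq> y $ 2"
  obtains a b where "x = vec a + b *\<^sub>R y"
proof -
  define b where "b = (x $ 1 - x $ 2) / (y $ 1 - y $ 2)"
  have "b * (y $ 1 - y $ 2) = x $ 1 - x $ 2" using assms by (simp add: b_def)
  hence "x = vec (x $ 1 - b * y $ 1) + b *\<^sub>R y"
    by (simp add: vec_eq_iff forall_2 algebra_simps)
  thus ?thesis by (rule that)
qed

text \<open>Constant vectors have eigenvalue 1 under a stochastic matrix.\<close>

lemma eigenvector_2_nonconstant: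
  fixes A :: "real ^ 2 ^ 2"
  assumes A: "stochastic_matrix A" and y: "A *v y = \<mu> *\<^sub>R y" "y \<noteq> 0" and \<mu>: "\<mu> \<noteq> 1"
  shows "y $ 1 \<noteq> y $ 2"
proof
  assume "y $ 1 = y $ 2"
  hence const: "y = vec (y $ 1)" by (simp add: vec_eq_iff forall_2)
  have "\<mu> *\<^sub>R y = y" using stochastic_mult_vec[OF A, of "y $ 1"] const y(1) by simp
  hence "(\<mu> - 1) *\<^sub>R y = 0" by (simp add: scaleR_diff_left)
  thus False using \<mu> y(2) by simp
qed

text \<open>With two states, a vanishing off-diagonal entry makes the matrix triangular, and so are all its
powers.\<close>

lemma irreducible_2_offdiagonal:
  fixes A :: "real ^ 2 ^ 2"
  assumes irr: "irreducible_matrix A" and ij: "i \<noteq> j"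
  shows "A $ i $ j \<noteq> 0"
proof
  assume zero: "A $ i $ j = 0"
  have two: "k = i \<or> k = j" for k using ij exhaust_2[of i] exhaust_2[of j] exhaust_2[of k] by auto
  have "(((**) A) ^^ n) (mat 1) $ i $ j = 0" for n
  proof (induction n)
    case 0
    thus ?case using ij by (simp add: mat_def)
  next
    case (Suc n)
    have "A $ i $ k * (((**) A) ^^ n) (mat 1) $ k $ j = 0" for k
      using two[of k] zero Suc by auto
    hence "(\<Sum>k\<in>UNIV. A $ i $ k * (((**) A) ^^ n) (mat 1) $ k $ j) = 0"
      by (intro sum.neutral) blast
    moreover have "(A ** B) $ i $ j = (\<Sum>k\<in>UNIV. A $ i $ k * B $ k $ j)" for B
      by (simp add: matrix_matrix_mult_def)
    ultimately show ?case by simp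
  qed
  thus False using irr unfolding irreducible_matrix_def by (metis less_irrefl)
qed

text \<open>If \<open>y\<close> vanished at one of the two states, the eigenvector equation there would read
\<open>A\<^sub>i\<^sub>j y\<^sub>j = 0\<close>, and irreducibility would give \<open>y = 0\<close>. So both entries of \<open>y\<close> are nonzero.\<close>

lemma stationary_square_pos:
  fixes A :: "real ^ 2 ^ 2"
  assumes irr: "irreducible_matrix A" and p: "prob_vector p"
    and y: "A *v y = \<mu> *\<^sub>R y" "y \<noteq> 0"
  shows "0 < p \<bullet> square_vec y"
proof -
  have p_nonneg: "0 \<le> p $ 1" "0 \<le> p $ 2" and p_sum: "p $ 1 + p $ 2 = 1"
    using p by (auto simp: prob_vector_def sum_2)
  have nonzero: "y $ i \<noteq> 0" for i
  proof
    assume zero: "y $ i = 0"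
    obtain j where j: "j \<noteq> i" "UNIV = {i, j}"
    proof (cases "i = 1")
      case True
      show ?thesis by (rule that[of 2]) (simp_all add: True UNIV_2)
    next
      case False
      hence "i = 2" using exhaust_2[of i] by simp
      show ?thesis by (rule that[of 1]) (auto simp: \<open>i = 2\<close> UNIV_2)
    qed
    have "(A *v y) $ i = (\<Sum>k\<in>{i, j}. A $ i $ k * y $ k)"
      unfolding j(2)[symmetric] by (simp add: matrix_vector_mult_def)
    also have "\<dots> = A $ i $ j * y $ j" using j(1) zero by simp
    finally have "(A *v y) $ i = A $ i $ j * y $ j" .
    moreover have "(A *v y) $ i = 0" using y zero by simp
    moreover have "A $ i $ j \<noteq> 0" using irreducible_2_offdiagonal[OF irr, of i j] j by simp
    ultimately have "y $ j = 0" by simp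
    have "y $ k = 0" for k
    proof -
      have "k = i \<or> k = j" using j(2) by blast
      thus ?thesis using zero \<open>y $ j = 0\<close> by blast
    qed
    thus False using y(2) by (simp add: vec_eq_iff)
  qed
  have "p \<bullet> square_vec y = p $ 1 * (y $ 1)\<^sup>2 + p $ 2 * (y $ 2)\<^sup>2"
    by (simp add: inner_vec_def sum_2 square_vec_def)
  moreover have "0 < p $ 1 \<or> 0 < p $ 2" using p_nonneg p_sum by linarith
  ultimately show ?thesis
    using p_nonneg nonzero by (auto intro: add_pos_nonneg add_nonneg_pos)
qed

theorem proposition4p3:
  fixes M :: "'a measure"
    and P Q E :: "real ^ 2 ^ 2"
    and R :: "real ^ colour ^ colour"
    and c0 v3 :: "real ^ colour"
    and X :: "nat \<Rightarrow> 'a \<Rightarrow> colour"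
    and C :: "nat \<Rightarrow> 'a \<Rightarrow> real ^ colour"
    and \<pi>\<^sub>P \<nu> :: "real ^ 2"
    and s l \<beta> :: real
  assumes urn: "urn_process M R c0 X C"
    and R: "R = block_matrix (s *\<^sub>R Q) E 0 P"
    and s: "0 < s" "s < 1"
    and P: "stochastic_matrix P" "irreducible_matrix P"
    and Q: "stochastic_matrix Q" "irreducible_matrix Q"
    and \<pi>\<^sub>P: "stationary_distribution \<pi>\<^sub>P P"
    and eig_Q: "eigenvalues Q = {l, 1}" "\<bar>l\<bar> < 1"
    and eig_P: "eigenvalues P = {\<beta>, 1}" "\<bar>\<beta>\<bar> < 1"
    and start: "c0 $ white + c0 $ black > 0"
    and distinct_eig: "distinct [s * l, s, \<beta>, 1]"
    and v3: "right_eigenvector R \<beta> v3"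
    and \<nu>: "\<nu> = lower_half v3"
  shows "(\<beta> < 1 / 2 \<longrightarrow>
            converges_in_distribution M (\<lambda>n \<omega>. (C n \<omega> \<bullet> v3) / sqrt (real n))
              (normal_law 0 (\<beta>\<^sup>2 / (1 - 2 * \<beta>) * (\<pi>\<^sub>P \<bullet> square_vec \<nu>)))) \<and>
         (\<beta> = 1 / 2 \<longrightarrow>
            converges_in_distribution M (\<lambda>n \<omega>. (C n \<omega> \<bullet> v3) / sqrt (real n * ln (real n)))
              (normal_law 0 (\<beta>\<^sup>2 * (\<pi>\<^sub>P \<bullet> square_vec \<nu>)))) \<and>
         (\<beta> > 1 / 2 \<longrightarrow>
            martingale M (natural_filtration M C) (\<lambda>n \<omega>. (C n \<omega> \<bullet> v3) / Pi_norm n \<beta>) \<and>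
            L2_bounded M (\<lambda>n \<omega>. (C n \<omega> \<bullet> v3) / Pi_norm n \<beta>) \<and>
            (\<exists>Z. nondegenerate M Z \<and>
              (AE \<omega> in M. (\<lambda>n. (C n \<omega> \<bullet> v3) / real n powr \<beta>) \<longlonglongrightarrow> Z \<omega>)))"
proof -
  interpret urn_process M R c0 X C by (rule urn)
  have lower: "\<beta> > -1" and upper: "\<beta> < 1" using eig_P(2) by auto
  have eig: "R *v v3 = \<beta> *\<^sub>R v3" and v3_nonzero: "v3 \<noteq> 0"
    using v3 by (auto simp: right_eigenvector_def)
  have eig_\<nu>: "P *v \<nu> = \<beta> *\<^sub>R \<nu>"
  proof -
    have "(P *v \<nu>) $ b = (\<beta> *\<^sub>R \<nu>) $ b" for b
      using arg_cong[OF eig, of "\<lambda>x. x $ Inr b"]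
      unfolding R block_triangular_mult by (simp add: \<nu> lower_half_def)
    thus ?thesis by (simp add: vec_eq_iff)
  qed
  \<comment> \<open>Otherwise the upper half of \<open>v3\<close> is an eigenvector of \<open>s Q\<close>, against the distinctness of the
    eigenvalues.\<close>
  have \<nu>_nonzero: "\<nu> \<noteq> 0"
  proof
    assume zero: "\<nu> = 0"
    define x where "x = (\<chi> i. v3 $ Inl i)"
    have "((s *\<^sub>R Q) *v x) $ a = (\<beta> *\<^sub>R x) $ a" for a
      using arg_cong[OF eig, of "\<lambda>x. x $ Inl a"] zero
      unfolding R block_triangular_mult by (simp add: \<nu>[symmetric] x_def)
    hence "(s *\<^sub>R Q) *v x = \<beta> *\<^sub>R x" by (simp add: vec_eq_iff)
    hence "s *\<^sub>R (Q *v x) = \<beta> *\<^sub>R x" by (simp add: scaleR_matrix_vector_assoc)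
    hence "Q *v x = (\<beta> / s) *\<^sub>R x" using s(1)
      by (metis divide_inverse_commute less_irrefl scaleR_scaleR scaleR_one left_inverse)
    moreover have "x \<noteq> 0"
    proof
      assume "x = 0"
      hence "v3 $ i = 0" for i
      proof (cases i)
        case (Inl a)
        thus ?thesis using arg_cong[OF \<open>x = 0\<close>, of "\<lambda>x. x $ a"] by (simp add: x_def)
      next
        case (Inr b)
        thus ?thesis using arg_cong[OF zero, of "\<lambda>x. x $ b"] by (simp add: \<nu> lower_half_def)
      qed
      thus False using v3_nonzero by (simp add: vec_eq_iff)
    qed
    ultimately have "\<beta> / s \<in> eigenvalues Q" by (auto simp: eigenvalues_def right_eigenvector_def)
    hence "\<beta> = s * l \<or> \<beta> = s" using s(1) eig_Q(1) by (auto simp: field_simps)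
    thus False using distinct_eig by auto
  qed
  define \<tau> where "\<tau> = \<pi>\<^sub>P \<bullet> square_vec \<nu>"
  have prob_\<pi>: "prob_vector \<pi>\<^sub>P" and stat_\<pi>: "\<pi>\<^sub>P v* P = \<pi>\<^sub>P"
    using \<pi>\<^sub>P by (auto simp: stationary_distribution_def)
  have \<tau>_pos: "0 < \<tau>"
    unfolding \<tau>_def by (rule stationary_square_pos[OF P(2) prob_\<pi> eig_\<nu> \<nu>_nonzero])
  \<comment> \<open>Left and right eigenvectors for different eigenvalues are orthogonal.\<close>
  have \<pi>\<nu>: "\<pi>\<^sub>P \<bullet> \<nu> = 0"
  proof -
    have "\<pi>\<^sub>P \<bullet> \<nu> = (\<pi>\<^sub>P v* P) \<bullet> \<nu>" by (simp add: stat_\<pi>)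
    also have "\<dots> = \<beta> * (\<pi>\<^sub>P \<bullet> \<nu>)" by (simp add: dot_lmul_matrix eig_\<nu>)
    finally have "(1 - \<beta>) * (\<pi>\<^sub>P \<bullet> \<nu>) = 0" by (simp add: algebra_simps)
    thus ?thesis using eig_P(2) by auto
  qed
  obtain q where q: "Q *v q = l *\<^sub>R q" "q \<noteq> 0"
    using eig_Q(1) by (auto simp: eigenvalues_def right_eigenvector_def)
  have lln: "(\<lambda>n. expectation (\<lambda>\<omega>. \<bar>C n \<omega> \<bullet> square_vec v3 / real (Suc n) - \<tau>\<bar>)) \<longlonglongrightarrow> 0"
  proof -
    obtain a b where ab: "square_vec \<nu> = vec a + b *\<^sub>R \<nu>"
      using vec_2_combination[of \<nu> "square_vec \<nu>"]
        eigenvector_2_nonconstant[OF P(1) eig_\<nu> \<nu>_nonzero] eig_P(2) by auto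
    have "\<tau> = \<pi>\<^sub>P \<bullet> vec a"
      unfolding \<tau>_def ab by (simp add: inner_add_right \<pi>\<nu>)
    also have "\<dots> = a"
      using prob_\<pi> by (simp add: inner_vec_def prob_vector_def sum_distrib_right[symmetric])
    finally have a: "a = \<tau>" ..
    \<comment> \<open>What is left of \<open>square_vec v3\<close> lives on the upper block, where the constants and \<open>q\<close> are
      eigenvectors of \<open>s Q\<close>.\<close>
    define z :: "real ^ 2" where "z = (\<chi> i. (square_vec v3 - vec a - b *\<^sub>R v3) $ Inl i)"
    obtain c d where cd: "z = vec c + d *\<^sub>R q"
      using vec_2_combination[of q z] eigenvector_2_nonconstant[OF Q(1) q] eig_Q(2) by auto
    define e where "e = (\<lambda>i::nat. if i = 0 then b *\<^sub>R v3
      else if i = 1 then upper_embedding (vec c) else upper_embedding (d *\<^sub>R q))"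
    define \<mu> where "\<mu> = (\<lambda>i::nat. if i = 0 then \<beta> else if i = 1 then s else s * l)"
    show ?thesis
    proof (rule law_of_large_numbers[of "{0, 1, 2}" e \<mu>])
      have "s * l < 1" using s eig_Q(2) by (smt (verit) mult_le_cancel_left1 mult_left_le)
      thus "\<mu> i < 1" if "i \<in> {0, 1, 2}" for i
        using upper s(2) by (simp add: \<mu>_def)
      have "R *v upper_embedding (vec c) = s *\<^sub>R upper_embedding (vec c)"
        unfolding R by (rule block_triangular_upper_eigenvector)
          (simp only: scaleR_matrix_vector_assoc[symmetric] stochastic_mult_vec[OF Q(1)])
      moreover have "R *v upper_embedding (d *\<^sub>R q) = (s * l) *\<^sub>R upper_embedding (d *\<^sub>R q)"
        unfolding R by (rule block_triangular_upper_eigenvector)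
          (simp only: scaleR_matrix_vector_assoc[symmetric] matrix_vector_mult_scaleR q(1) scaleR_scaleR mult_ac)
      ultimately show "R *v e i = \<mu> i *\<^sub>R e i" if "i \<in> {0, 1, 2}" for i
        using that by (auto simp: e_def \<mu>_def matrix_vector_mult_scaleR eig)
      have "square_vec v3 $ i = (vec \<tau> + (b *\<^sub>R v3 + (upper_embedding (vec c) + upper_embedding (d *\<^sub>R q)))) $ i" for i
      proof (cases i)
        case (Inl k)
        have "z $ k = (vec c + d *\<^sub>R q) $ k" by (simp add: cd)
        thus ?thesis using Inl by (simp add: z_def a)
      next
        case (Inr k)
        have "square_vec \<nu> $ k = (vec a + b *\<^sub>R \<nu>) $ k" by (simp add: ab)
        thus ?thesis using Inr by (simp add: square_vec_def \<nu> lower_half_def a)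
      qed
      thus "square_vec v3 = vec \<tau> + (\<Sum>i\<in>{0, 1, 2}. e i)"
        unfolding vec_eq_iff by (simp add: e_def)
    qed simp
  qed
  show ?thesis
    unfolding \<tau>_def[symmetric]
  proof (intro conjI impI)
    assume "\<beta> < 1 / 2"
    thus "converges_in_distribution M (\<lambda>n \<omega>. (C n \<omega> \<bullet> v3) / sqrt (real n))
        (normal_law 0 (\<beta>\<^sup>2 / (1 - 2 * \<beta>) * \<tau>))"
      using \<tau>_pos by (intro eigenvector_diffusive_limit[OF eig lower _ _ lln]) auto
  next
    assume half: "\<beta> = 1 / 2"
    show "converges_in_distribution M (\<lambda>n \<omega>. (C n \<omega> \<bullet> v3) / sqrt (real n * ln (real n)))
        (normal_law 0 (\<beta>\<^sup>2 * \<tau>))"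
      using eigenvector_critical_limit[OF eig[unfolded half] _ lln] \<tau>_pos by (simp add: half)
  next
    assume "1 / 2 < \<beta>"
    thus "martingale M (natural_filtration M C) (\<lambda>n \<omega>. (C n \<omega> \<bullet> v3) / Pi_norm n \<beta>)"
      "L2_bounded M (\<lambda>n \<omega>. (C n \<omega> \<bullet> v3) / Pi_norm n \<beta>)"
      "\<exists>Z. nondegenerate M Z \<and> (AE \<omega> in M. (\<lambda>n. (C n \<omega> \<bullet> v3) / real n powr \<beta>) \<longlonglongrightarrow> Z \<omega>)"
      using eigenvector_martingale[OF eig lower] eigenvector_L2_bounded[OF eig]
        eigenvector_almost_sure_limit[OF eig _ upper \<tau>_pos lln] by auto
  qed
qed

end
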